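(* Let $L\subset S^3$ be an oriented link with odd Khovanov homology $\mathrm{Kh}'(L)=\bigoplus_{m,s}\mathrm{Kh}'_{m,s}(L)$. There is a bigraded abelian group $\overline{\mathrm{Kh}'}(L)=\bigoplus_{m,s\in\mathbb Z}\overline{\mathrm{Kh}'}_{m,s}(L)$ with the property that for all $m,s\in\mathbb Z$ $$\mathrm{Kh}'_{m,s}(L)\cong\overline{\mathrm{Kh}'}_{m,s-1}(L)\oplus\overline{\mathrm{Kh}'}_{m,s+1}(L).$$
   Context: Resolutions and arrows. Let $\mathcal D$ be a planar diagram of $L$ with set of crossings $\mathcal X$, with $n_+$ positive and $n_-$ negative crossings. Near a crossing, drawn so that the over-strand runs from upper left to lower right, the $0$-resolution joins the two upper ends by an arc and the two lower ends by an arc, and the $1$-resolution joins the two left ends and the two right ends. At each crossing $x$ let $\gamma_x$ be a short arc at $x$ joining the two strands of the $0$-resolution; surgery along $\gamma_x$ turns the $0$-resolution into the $1$-resolution. Choose an orientation (arrow) on each $\gamma_x$. Rotating the arrow $90^\circ$ counterclockwise gives an oriented arc $\gamma_x^*$ joining the two strands of the $1$-resolution at $x$. Hypercube. Vertices are maps $I:\mathcal X\to\{0,1\}$; $\mathcal D(I)$ is the collection of disjoint planar circles obtained by resolving each $x$ according to $I(x)$. There is an edge $e$ from $I_0$ to $I_1$ if they agree except at one crossing $x$, where $I_0(x)=0$, $I_1(x)=1$. $V(\mathcal D(I))$ is the free abelian group on the circles of $\mathcal D(I)$. The map $F_e:\Lambda^*V(\mathcal D(I_0))\to\Lambda^*V(\mathcal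 D(I_1))$ is: (merge) if circles $a_1,a_2$ of $\mathcal D(I_0)$ are joined, $F_e$ is induced by $V(\mathcal D(I_0))\to V(\mathcal D(I_0))/(a_1-a_2)\cong V(\mathcal D(I_1))$; (split) if a circle divides into $a_1,a_2$, with $\gamma_x^*$ pointing from $a_1$ to $a_2$, then $F_e(v)=(a_1-a_2)\wedge\tilde v$, where $\tilde v$ is any lift of $v$ under $\Lambda^*V(\mathcal D(I_1))\to\Lambda^*(V(\mathcal D(I_1))/(a_1-a_2))\cong\Lambda^*V(\mathcal D(I_0))$. Types of squares. A square face is given by a vertex $I_{00}$ and crossings $x_1,x_2$ with $I_{00}(x_1)=I_{00}(x_2)=0$. If the two composites of edge maps around the square are nonzero, they agree up to sign; the square is of type $C$ if they are equal, type $A$ if they are negatives. They are both zero exactly when $\gamma_{x_1},\gamma_{x_2}$ have all endpoints on one circle of $\mathcal D(I_{00})$ and these interleave; then one arc lies inside the circle and the other outside. Traverse the circle counterclockwise from the tail of the inside arc: the square is of type $X$ if the next endpoint met is the tail of the outside arc, type $Y$ if it is the head. Edge assignments. Maps $\epsilon:\{\text{edges}\}\to\{\pm1\}$; a square is even (odd) if it has an even (odd) number of edges with $\epsilon=-1$. Type $X$: squares of types $A,X$ are even and of types $C,Y$ odd. Type $Y$: squares of types $A,Y$ are even and of types $C,X$ odd. Odd Khovanov homology. $C(\mathcal D)=\bigoplus_I\Lambda^*V(\mathcal D(I))$, $\partial_\epsilon(v)=\sum_e\epsilon(e)F_e(v)$ over edges $e$ starting at $I$, for $v\in\Lambda^*V(\mathcal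 D(I))$, with $\epsilon$ of type $X$ or $Y$. On $\Lambda^rV(\mathcal D(I))$ put $M_0=\sum_xI(x)$, $Q_0=\operatorname{rank}V(\mathcal D(I))-2r$, homological grading $m=M_0-n_-$, $q$-grading $s=Q_0+M_0+n_+-2n_-$. $\mathrm{Kh}'_{m,s}(L)$ is the bigraded homology of $(C(\mathcal D),\partial_\epsilon)$; up to isomorphism it depends only on $L$. *)

theory Defs
  imports "HOL-Algebra.Coset" "HOL-Combinatorics.Orbits" "HOL-Library.Function_Algebras"
begin

section \<open>Oriented planar link diagrams\<close>

text \<open>
  A diagram is given by a planar diagram code. The four corners of a crossing \<open>x\<close> are numbered
  counterclockwise by \<open>0, 1, 2, 3\<close>, where corner \<open>0\<close> is the incoming end of the under-strand; so the
  under-strand runs from \<open>0\<close> to \<open>2\<close> and the over-strand joins \<open>1\<close> and \<open>3\<close>. Rotated so that the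
  over-strand goes from upper left to lower right, the corners are
  upper right (\<open>0\<close>), upper left (\<open>1\<close>), lower left (\<open>2\<close>), lower right (\<open>3\<close>), or the same
  turned by 180 degrees. \<open>edge_at D x i\<close> is the label of the edge of the diagram at corner \<open>i\<close> of
  \<open>x\<close>, \<open>positive D x\<close> gives the sign of \<open>x\<close>, and \<open>loops D\<close> labels the components
  without crossings (whose orientation affects neither the link up to isotopy nor the complex).
\<close>

record diagram =
  crossings :: "nat set"
  edge_at :: "nat \<Rightarrow> nat \<Rightarrow> nat"
  positive :: "nat \<Rightarrow> bool"
  loops :: "nat set"

definition corners :: "diagram \<Rightarrow> (nat \<times> nat) set" where
  "corners D = crossings D \<times> {0..<4}"

definition label :: "diagram \<Rightarrow> nat \<times> nat \<Rightarrow> nat" where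
  "label D = (\<lambda>(x, i). edge_at D x i)"

definition diagram_edges :: "diagram \<Rightarrow> nat set" where
  "diagram_edges D = label D ` corners D \<union> loops D"

text \<open>At a positive crossing the over-strand runs from corner 3 to corner 1.\<close>

definition incoming :: "diagram \<Rightarrow> (nat \<times> nat) set" where
  "incoming D = {(x, i) \<in> corners D. i = 0 \<or> i = (if positive D x then 3 else 1)}"

definition outgoing :: "diagram \<Rightarrow> (nat \<times> nat) set" where
  "outgoing D = corners D - incoming D"

text \<open>The other end of the edge that leaves a crossing at a given corner.\<close>

definition mate :: "diagram \<Rightarrow> nat \<times> nat \<Rightarrow> nat \<times> nat" where
  "mate D d = (THE d'. d' \<in> corners D \<and> d' \<noteq> d \<and> label D d' = label D d)"

definition face_step :: "diagram \<Rightarrow> nat \<times> nat \<Rightarrow> nat \<times> nat" where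
  "face_step D d = (case mate D d of (y, j) \<Rightarrow> (y, (j + 1) mod 4))"

definition faces :: "diagram \<Rightarrow> (nat \<times> nat) set set" where
  "faces D = orbit (face_step D) ` corners D"

definition adjacent :: "diagram \<Rightarrow> (nat \<times> nat) set" where
  "adjacent D = {(x, y) \<in> crossings D \<times> crossings D.
     \<exists>i<4. \<exists>j<4. edge_at D x i = edge_at D y j}"

definition pieces :: "diagram \<Rightarrow> nat set set" where
  "pieces D = crossings D // (adjacent D)\<^sup>*"

text \<open>
  Every edge that is not a loop leaves one crossing corner and enters one. The last condition is
  Euler's formula \<open>V - E + F = 2 c\<close> with \<open>E = 2 V\<close>, where \<open>c\<close> is the number of connected pieces
  (each drawn on its own sphere): as no piece contributes more than 2, it says
  that every piece has genus 0. How the pieces and loops are placed relative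
  to each other in the plane does not affect the link up to isotopy.
\<close>

definition planar_diagram :: "diagram \<Rightarrow> bool" where
  "planar_diagram D \<longleftrightarrow>
     finite (crossings D) \<and> finite (loops D) \<and>
     loops D \<inter> label D ` corners D = {} \<and>
     inj_on (label D) (incoming D) \<and> inj_on (label D) (outgoing D) \<and>
     label D ` incoming D = label D ` outgoing D \<and>
     card (faces D) = card (crossings D) + 2 * card (pieces D)"

definition n_plus :: "diagram \<Rightarrow> nat" where
  "n_plus D = card {x \<in> crossings D. positive D x}"

definition n_minus :: "diagram \<Rightarrow> nat" where
  "n_minus D = card {x \<in> crossings D. \<not> positive D x}"


section \<open>Resolutions\<close>

text \<open>
  \<open>across b i\<close> is the corner joined to corner \<open>i\<close> by the \<open>b\<close>-resolution: the strands are
  \<open>{0, 1}, {2, 3}\<close> for \<open>b = 0\<close> and \<open>{1, 2}, {3, 0}\<close> for \<open>b = 1\<close>.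
\<close>

definition across :: "nat \<Rightarrow> nat \<Rightarrow> nat" where
  "across b i = (if even (b + i) then (i + 1) mod 4 else (i + 3) mod 4)"

definition vertices :: "diagram \<Rightarrow> (nat \<Rightarrow> nat) set" where
  "vertices D = crossings D \<rightarrow>\<^sub>E {0, 1}"

definition joined :: "diagram \<Rightarrow> (nat \<Rightarrow> nat) \<Rightarrow> (nat \<times> nat) set" where
  "joined D I = {(edge_at D x i, edge_at D x (across (I x) i)) | x i. x \<in> crossings D \<and> i < 4}"

text \<open>A circle of \<open>D(I)\<close> is a class of edges; it is represented by its least edge.\<close>

definition circle_of :: "diagram \<Rightarrow> (nat \<Rightarrow> nat) \<Rightarrow> nat \<Rightarrow> nat" where
  "circle_of D I e = Min ((joined D I)\<^sup>* `` {e})"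

definition circles :: "diagram \<Rightarrow> (nat \<Rightarrow> nat) \<Rightarrow> nat set" where
  "circles D I = circle_of D I ` diagram_edges D"


section \<open>Exterior algebra of a free abelian group\<close>

text \<open>
  Let \<open>V\<close> be the free abelian group on a finite linearly ordered set \<open>C\<close>. An element of the exterior
  algebra of \<open>V\<close> is given by its coefficients with respect to the basis
  \<open>c\<^sub>1 \<and> \<dots> \<and> c\<^sub>k\<close> with \<open>c\<^sub>1 < \<dots> < c\<^sub>k\<close>, indexed by the subsets \<open>{c\<^sub>1, \<dots>, c\<^sub>k}\<close> of \<open>C\<close>.
\<close>

definition ext_alg :: "'a::linorder set \<Rightarrow> ('a set \<Rightarrow> int) set" where
  "ext_alg C = {f. \<forall>S. f S \<noteq> 0 \<longrightarrow> S \<subseteq> C}"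

definition gen :: "'a::linorder \<Rightarrow> 'a set \<Rightarrow> int" where
  "gen a = (\<lambda>S. if S = {a} then 1 else 0)"

definition wedge :: "('a::linorder set \<Rightarrow> int) \<Rightarrow> ('a set \<Rightarrow> int) \<Rightarrow> 'a set \<Rightarrow> int" where
  "wedge f g = (\<lambda>S. \<Sum>T\<in>Pow S.
     (- 1) ^ card {(t, u) \<in> T \<times> (S - T). u < t} * f T * g (S - T))"

text \<open>
  The ring homomorphism induced by the linear map that sends each basis element \<open>a\<close> in \<open>C\<close> to the
  basis element \<open>h a\<close>; \<open>h c\<^sub>1 \<and> \<dots> \<and> h c\<^sub>k\<close> vanishes unless the \<open>h c\<^sub>i\<close> are distinct, and is otherwise
  sorted at the cost of the sign of the permutation.
\<close>

definition ext_map ::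
  "'a::linorder set \<Rightarrow> ('a \<Rightarrow> 'b::linorder) \<Rightarrow> ('a set \<Rightarrow> int) \<Rightarrow> 'b set \<Rightarrow> int" where
  "ext_map C h f = (\<lambda>T. \<Sum>S | S \<subseteq> C \<and> inj_on h S \<and> h ` S = T.
     (- 1) ^ card {(a, b) \<in> S \<times> S. a < b \<and> h b < h a} * f S)"


section \<open>Edge maps of the hypercube\<close>

text \<open>
  An edge is a pair \<open>(I, x)\<close> with \<open>I x = 0\<close>; it goes from \<open>I\<close> to \<open>I(x := 1)\<close>. A choice of arrows is
  \<open>arr :: nat \<Rightarrow> bool\<close>: the arrow at \<open>x\<close> points from strand \<open>{0, 1}\<close> to strand \<open>{2, 3}\<close> of the
  0-resolution if \<open>arr x\<close>, and the other way otherwise. \<open>tail_corner\<close> and \<open>head_corner\<close> give the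
  first corner \<open>p\<close> of the strand \<open>{p, p + 1}\<close> at the tail and the head. Rotating the arrow by 90
  degrees counterclockwise adds 1 to all corners (mod 4).
\<close>

definition cube_edges :: "diagram \<Rightarrow> ((nat \<Rightarrow> nat) \<times> nat) set" where
  "cube_edges D = {(I, x). I \<in> vertices D \<and> x \<in> crossings D \<and> I x = 0}"

definition tail_corner :: "(nat \<Rightarrow> bool) \<Rightarrow> nat \<Rightarrow> nat" where
  "tail_corner arr x = (if arr x then 0 else 2)"

definition head_corner :: "(nat \<Rightarrow> bool) \<Rightarrow> nat \<Rightarrow> nat" where
  "head_corner arr x = (if arr x then 2 else 0)"

text \<open>
  Since circles are represented by edges, \<open>circle_of D (I(x := 1))\<close> sends a circle of \<open>D(I)\<close> to its
  image under a merge, and \<open>circle_of D I\<close> sends a circle of \<open>D(I(x := 1))\<close> to the circle of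
  \<open>D(I)\<close> it comes from under a split; these maps of circles induce the identifications of
  \<open>V/(a\<^sub>1 - a\<^sub>2)\<close> with the free abelian group on the merged circles.
\<close>

definition edge_map ::
  "diagram \<Rightarrow> (nat \<Rightarrow> bool) \<Rightarrow> (nat \<Rightarrow> nat) \<Rightarrow> nat \<Rightarrow> (nat set \<Rightarrow> int) \<Rightarrow> nat set \<Rightarrow> int" where
  "edge_map D arr I x v =
     (let J = I(x := 1) in
      if circle_of D I (edge_at D x 0) \<noteq> circle_of D I (edge_at D x 2)
      then ext_map (circles D I) (circle_of D J) v
      else
        (let a1 = circle_of D J (edge_at D x (tail_corner arr x + 1));
             a2 = circle_of D J (edge_at D x (head_corner arr x + 1))
         in THE w. \<exists>v' \<in> ext_alg (circles D J).
              ext_map (circles D J) (circle_of D I) v' = v \<and> w = wedge (gen a1 - gen a2) v'))"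


section \<open>Types of squares and edge assignments\<close>

definition squares :: "diagram \<Rightarrow> ((nat \<Rightarrow> nat) \<times> nat \<times> nat) set" where
  "squares D = {(I, x, y). I \<in> vertices D \<and> x \<in> crossings D \<and> y \<in> crossings D \<and> x \<noteq> y \<and>
     I x = 0 \<and> I y = 0}"

definition square_edges :: "(nat \<Rightarrow> nat) \<times> nat \<times> nat \<Rightarrow> ((nat \<Rightarrow> nat) \<times> nat) set" where
  "square_edges = (\<lambda>(I, x, y). {(I, x), (I, y), (I(x := 1), y), (I(y := 1), x)})"

text \<open>The composite of edge maps that changes the resolution first at \<open>x\<close> and then at \<open>y\<close>.\<close>

definition composite ::
  "diagram \<Rightarrow> (nat \<Rightarrow> bool) \<Rightarrow> (nat \<Rightarrow> nat) \<Rightarrow> nat \<Rightarrow> nat \<Rightarrow> (nat set \<Rightarrow> int) \<Rightarrow> nat set \<Rightarrow> int" where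
  "composite D arr I x y v = edge_map D arr (I(x := 1)) y (edge_map D arr I x v)"

definition type_C :: "diagram \<Rightarrow> (nat \<Rightarrow> bool) \<Rightarrow> (nat \<Rightarrow> nat) \<times> nat \<times> nat \<Rightarrow> bool" where
  "type_C D arr = (\<lambda>(I, x, y).
     (\<exists>v \<in> ext_alg (circles D I). composite D arr I x y v \<noteq> 0) \<and>
     (\<forall>v \<in> ext_alg (circles D I). composite D arr I x y v = composite D arr I y x v))"

definition type_A :: "diagram \<Rightarrow> (nat \<Rightarrow> bool) \<Rightarrow> (nat \<Rightarrow> nat) \<times> nat \<times> nat \<Rightarrow> bool" where
  "type_A D arr = (\<lambda>(I, x, y).
     (\<exists>v \<in> ext_alg (circles D I). composite D arr I x y v \<noteq> 0) \<and>
     (\<forall>v \<in> ext_alg (circles D I). composite D arr I x y v = - composite D arr I y x v))"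

text \<open>
  Traversing a circle of \<open>D(I)\<close>: leave a crossing at corner \<open>d\<close>, follow the edge to its other end, and
  pass along the strand of the resolution found there; the value is the corner at which that crossing is left.
\<close>

definition traverse :: "diagram \<Rightarrow> (nat \<Rightarrow> nat) \<Rightarrow> nat \<times> nat \<Rightarrow> nat \<times> nat" where
  "traverse D I d = (case mate D d of (y, j) \<Rightarrow> (y, across (I y) j))"

text \<open>Starting from \<open>a\<close>, the points \<open>b\<close>, \<open>c\<close>, \<open>d\<close> are met in this order before the return to \<open>a\<close>.\<close>

definition in_cyclic_order :: "('a \<Rightarrow> 'a) \<Rightarrow> 'a \<Rightarrow> 'a \<Rightarrow> 'a \<Rightarrow> 'a \<Rightarrow> bool" where
  "in_cyclic_order f a b c d \<longleftrightarrow>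
     (\<exists>i j k. 0 < i \<and> i < j \<and> j < k \<and> (f ^^ i) a = b \<and> (f ^^ j) a = c \<and> (f ^^ k) a = d \<and>
        (\<forall>l. 0 < l \<and> l \<le> k \<longrightarrow> (f ^^ l) a \<noteq> a))"

text \<open>
  Passing along the strand \<open>{p, p + 1}\<close> of a 0-resolution (\<open>p\<close> being 0 or 2) from \<open>p\<close> to \<open>p + 1\<close>,
  one has the arc of the crossing on the left; passing from \<open>p + 1\<close> to \<open>p\<close> one has it on the right. If a
  circle is traversed counterclockwise, its inside is on the left. So below
  \<open>x\<close> is the crossing of the inside arc and \<open>y\<close> that of the outside arc, and the four endpoints,
  recorded by the corner at which the respective strand is left, are met in the order
  tail, tail, head, head (type X) or tail, head, head, tail (type Y), where the
  first and the third belong to the inside arc.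

  No outer face has to be chosen: if the circle is instead traversed clockwise, left is outside, the
  arcs exchange their roles and the cyclic order is reversed, which leads to the same type.
  This is why the two crossings enter symmetrically.
\<close>

definition left_right_X :: "diagram \<Rightarrow> (nat \<Rightarrow> bool) \<Rightarrow> (nat \<Rightarrow> nat) \<Rightarrow> nat \<Rightarrow> nat \<Rightarrow> bool" where
  "left_right_X D arr I x y \<longleftrightarrow> in_cyclic_order (traverse D I)
     (x, tail_corner arr x + 1) (y, tail_corner arr y) (x, head_corner arr x + 1) (y, head_corner arr y)"

definition left_right_Y :: "diagram \<Rightarrow> (nat \<Rightarrow> bool) \<Rightarrow> (nat \<Rightarrow> nat) \<Rightarrow> nat \<Rightarrow> nat \<Rightarrow> bool" where
  "left_right_Y D arr I x y \<longleftrightarrow> in_cyclic_order (traverse D I)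
     (x, tail_corner arr x + 1) (y, head_corner arr y) (x, head_corner arr x + 1) (y, tail_corner arr y)"

definition type_X :: "diagram \<Rightarrow> (nat \<Rightarrow> bool) \<Rightarrow> (nat \<Rightarrow> nat) \<times> nat \<times> nat \<Rightarrow> bool" where
  "type_X D arr = (\<lambda>(I, x, y). left_right_X D arr I x y \<or> left_right_X D arr I y x)"

definition type_Y :: "diagram \<Rightarrow> (nat \<Rightarrow> bool) \<Rightarrow> (nat \<Rightarrow> nat) \<times> nat \<times> nat \<Rightarrow> bool" where
  "type_Y D arr = (\<lambda>(I, x, y). left_right_Y D arr I x y \<or> left_right_Y D arr I y x)"

definition even_square ::
  "((nat \<Rightarrow> nat) \<times> nat \<Rightarrow> int) \<Rightarrow> (nat \<Rightarrow> nat) \<times> nat \<times> nat \<Rightarrow> bool" where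
  "even_square \<epsilon> q \<longleftrightarrow> even (card {e \<in> square_edges q. \<epsilon> e = - 1})"

definition edge_assignment_X ::
  "diagram \<Rightarrow> (nat \<Rightarrow> bool) \<Rightarrow> ((nat \<Rightarrow> nat) \<times> nat \<Rightarrow> int) \<Rightarrow> bool" where
  "edge_assignment_X D arr \<epsilon> \<longleftrightarrow>
     (\<forall>e \<in> cube_edges D. \<epsilon> e \<in> {1, - 1}) \<and>
     (\<forall>q \<in> squares D.
        (type_A D arr q \<or> type_X D arr q \<longrightarrow> even_square \<epsilon> q) \<and>
        (type_C D arr q \<or> type_Y D arr q \<longrightarrow> \<not> even_square \<epsilon> q))"

definition edge_assignment_Y ::
  "diagram \<Rightarrow> (nat \<Rightarrow> bool) \<Rightarrow> ((nat \<Rightarrow> nat) \<times> nat \<Rightarrow> int) \<Rightarrow> bool" where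
  "edge_assignment_Y D arr \<epsilon> \<longleftrightarrow>
     (\<forall>e \<in> cube_edges D. \<epsilon> e \<in> {1, - 1}) \<and>
     (\<forall>q \<in> squares D.
        (type_A D arr q \<or> type_Y D arr q \<longrightarrow> even_square \<epsilon> q) \<and>
        (type_C D arr q \<or> type_X D arr q \<longrightarrow> \<not> even_square \<epsilon> q))"


section \<open>Odd Khovanov homology\<close>

type_synonym chain = "(nat \<Rightarrow> nat) \<Rightarrow> nat set \<Rightarrow> int"

definition hom_degree :: "diagram \<Rightarrow> (nat \<Rightarrow> nat) \<Rightarrow> int" where
  "hom_degree D I = int (\<Sum>x\<in>crossings D. I x) - int (n_minus D)"

definition q_degree :: "diagram \<Rightarrow> (nat \<Rightarrow> nat) \<Rightarrow> nat \<Rightarrow> int" where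
  "q_degree D I r = (int (card (circles D I)) - 2 * int r) + int (\<Sum>x\<in>crossings D. I x)
     + int (n_plus D) - 2 * int (n_minus D)"

text \<open>The part of \<open>C(D)\<close> of bidegree \<open>(m, s)\<close>; the component of a chain \<open>c\<close> at the vertex \<open>I\<close> is \<open>c I\<close>.\<close>

definition chain_group :: "diagram \<Rightarrow> int \<Rightarrow> int \<Rightarrow> chain monoid" where
  "chain_group D m s =
     \<lparr>carrier = {c. \<forall>I S. c I S \<noteq> 0 \<longrightarrow> I \<in> vertices D \<and> S \<subseteq> circles D I \<and>
                     hom_degree D I = m \<and> q_degree D I (card S) = s},
      monoid.mult = (+), one = 0\<rparr>"

definition boundary ::
  "diagram \<Rightarrow> (nat \<Rightarrow> bool) \<Rightarrow> ((nat \<Rightarrow> nat) \<times> nat \<Rightarrow> int) \<Rightarrow> chain \<Rightarrow> chain" where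
  "boundary D arr \<epsilon> c = (\<lambda>J S.
     \<Sum>(I, x) | (I, x) \<in> cube_edges D \<and> I(x := 1) = J. \<epsilon> (I, x) * edge_map D arr I x (c I) S)"

definition odd_Kh ::
  "diagram \<Rightarrow> (nat \<Rightarrow> bool) \<Rightarrow> ((nat \<Rightarrow> nat) \<times> nat \<Rightarrow> int) \<Rightarrow> int \<Rightarrow> int \<Rightarrow> chain set monoid" where
  "odd_Kh D arr \<epsilon> m s =
     (chain_group D m s)
       \<lparr>carrier := kernel (chain_group D m s) (chain_group D (m + 1) s) (boundary D arr \<epsilon>)\<rparr>
     Mod boundary D arr \<epsilon> ` carrier (chain_group D (m - 1) s)"

end

theory Submission
  imports Defs
begin

text \<open>
  Let \<open>L\<close> be exterior multiplication by the circle through a base point, and \<open>K\<close> contraction with the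
  functional that sends every circle to 1. With suitable signs, both commute with the differential, and
  \<open>K L + L K = 1\<close>, \<open>K K = 0\<close>. Hence every chain is \<open>u + L w\<close> for unique \<open>u\<close> and \<open>w\<close> in the
  kernel of \<open>K\<close>, so the complex is the direct sum of the subcomplex \<open>ker K\<close> and a copy of it with
  \<open>q\<close>-grading lowered by 2. The reduced homology is the homology of \<open>ker K\<close>, shifted by 1.
\<close>

section \<open>Operators on the exterior algebra\<close>

text \<open>The functional is constant on circles for two reasons. A map of circles then pulls the
  functional of its target back to that of its source, which settles merges and the lifts used in
  splits; and the factor \<open>a1 - a2\<close> of a split has value 0, so contraction passes it at
  the cost of a sign only. That the constant is the unit 1 makes the decomposition hold over the
  integers. The base point lies on an edge of the diagram, so a merge sends the circle through it to
  the circle through it, and in a split the new circle through it is a lift of the old one. The main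
  obstacle is the split map: it is defined through an arbitrary lift, and any identity about it
  first requires that two lifts have the same product with \<open>a1 - a2\<close>. Many identities
  between additive operators are reduced to the unit and to products with one generator, which
  confines the sign counts to a few lemmas about sorted products.\<close>

definition ext_one :: "'a set \<Rightarrow> int" where
  "ext_one = (\<lambda>S. if S = {} then 1 else 0)"

text \<open>The exponent counts the factors that a leading \<open>a\<close> passes on the way to its
  place in the sorted product indexed by \<open>S\<close>.\<close>

definition left_mult :: "'a::linorder \<Rightarrow> ('a set \<Rightarrow> int) \<Rightarrow> 'a set \<Rightarrow> int" where
  "left_mult a v = (\<lambda>S. if a \<in> S then (- 1) ^ card {s \<in> S. s < a} * v (S - {a}) else 0)"

text \<open>Interior product with the functional of value 1 on all of \<open>C\<close>: the sum
  collects the products from which one factor \<open>b\<close> is removed to leave \<open>S\<close>,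
  and the sign is that of moving \<open>b\<close> to the front.\<close>

definition contract :: "'a::linorder set \<Rightarrow> ('a set \<Rightarrow> int) \<Rightarrow> 'a set \<Rightarrow> int" where
  "contract C v = (\<lambda>S. \<Sum>b\<in>C - S. (- 1) ^ card {s \<in> S. s < b} * v (insert b S))"

definition twist :: "('a set \<Rightarrow> int) \<Rightarrow> 'a set \<Rightarrow> int" where
  "twist v = (\<lambda>S. (- 1) ^ card S * v S)"

section \<open>Closure, additivity and the unit\<close>

lemma ext_algI: "(\<And>S. v S \<noteq> 0 \<Longrightarrow> S \<subseteq> C) \<Longrightarrow> v \<in> ext_alg C"
  by (auto simp: ext_alg_def)

lemma ext_algD: "v \<in> ext_alg C \<Longrightarrow> \<not> S \<subseteq> C \<Longrightarrow> v S = 0"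
  by (auto simp: ext_alg_def)

lemma ext_alg_0 [simp]: "0 \<in> ext_alg C"
  by (auto intro!: ext_algI)

lemma ext_alg_diff: "v \<in> ext_alg C \<Longrightarrow> w \<in> ext_alg C \<Longrightarrow> v - w \<in> ext_alg C"
  by (rule ext_algI) (auto dest: ext_algD, metis ext_algD diff_0_right subsetD)

lemma ext_alg_uminus: "v \<in> ext_alg C \<Longrightarrow> - v \<in> ext_alg C"
  using ext_alg_diff[of 0 C v] by simp

lemma ext_one_in [simp]: "ext_one \<in> ext_alg C"
  by (auto intro!: ext_algI simp: ext_one_def split: if_splits)

lemma left_mult_in:
  assumes "a \<in> C" "v \<in> ext_alg C"
  shows "left_mult a v \<in> ext_alg C"
proof (rule ext_algI)
  fix S assume "left_mult a v S \<noteq> 0"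
  then have "v (S - {a}) \<noteq> 0" by (auto simp: left_mult_def split: if_splits)
  then have "S - {a} \<subseteq> C" using ext_algD[OF assms(2), of "S - {a}"] by blast
  then show "S \<subseteq> C" using assms(1) by blast
qed

lemma contract_in:
  assumes "v \<in> ext_alg C"
  shows "contract C v \<in> ext_alg C"
proof (rule ext_algI, rule ccontr)
  fix S assume *: "contract C v S \<noteq> 0" "\<not> S \<subseteq> C"
  then have "v (insert b S) = 0" for b
    using ext_algD[OF assms] by blast
  with * show False by (simp add: contract_def)
qed

lemma twist_in: "v \<in> ext_alg C \<Longrightarrow> twist v \<in> ext_alg C"
  by (rule ext_algI) (auto simp: twist_def dest: ext_algD)

lemma ext_map_in:
  assumes "h ` C \<subseteq> C'"
  shows "ext_map C h v \<in> ext_alg C'"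
proof (rule ext_algI, rule ccontr)
  fix T assume *: "ext_map C h v T \<noteq> 0" "\<not> T \<subseteq> C'"
  then have "{S. S \<subseteq> C \<and> inj_on h S \<and> h ` S = T} = {}"
    using assms by blast
  with * show False by (simp only: ext_map_def sum.empty)
qed

lemma left_mult_diff: "left_mult a (v - w) = left_mult a v - left_mult a w"
  by (auto simp: left_mult_def fun_eq_iff algebra_simps)

lemma contract_diff: "contract C (v - w) = contract C v - contract C w"
  by (auto simp: contract_def fun_eq_iff algebra_simps sum_subtractf)

lemma twist_diff: "twist (v - w) = twist v - twist w"
  by (auto simp: twist_def fun_eq_iff algebra_simps)

lemma ext_map_diff: "ext_map C h (v - w) = ext_map C h v - ext_map C h w"
  by (auto simp: ext_map_def fun_eq_iff algebra_simps sum_subtractf)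

lemma left_mult_0 [simp]: "left_mult a 0 = 0"
  using left_mult_diff[of a 0 0] by simp

lemma contract_0 [simp]: "contract C 0 = 0"
  using contract_diff[of C 0 0] by simp

lemma twist_0 [simp]: "twist 0 = 0"
  using twist_diff[of 0 0] by simp

lemma ext_map_0 [simp]: "ext_map C h 0 = 0"
  using ext_map_diff[of C h 0 0] by simp

lemma left_mult_uminus: "left_mult a (- v) = - left_mult a v"
  using left_mult_diff[of a 0 v] by simp

lemma contract_uminus: "contract C (- v) = - contract C v"
  using contract_diff[of C 0 v] by simp

lemma twist_uminus: "twist (- v) = - twist v"
  using twist_diff[of 0 v] by simp

lemma ext_map_uminus: "ext_map C h (- v) = - ext_map C h v"
  using ext_map_diff[of C h 0 v] by simp

lemma twist_twist [simp]: "twist (twist v) = v"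
  by (auto simp: twist_def fun_eq_iff simp flip: power_add mult.assoc)

lemma contract_ext_one [simp]: "contract C ext_one = 0"
  by (auto simp: contract_def ext_one_def fun_eq_iff)

lemma ext_map_ext_one [simp]: "ext_map C h ext_one = ext_one"
proof
  fix T
  have "ext_map C h ext_one T = (\<Sum>S | S \<subseteq> C \<and> inj_on h S \<and> h ` S = T. if S = {} then ext_one T else 0)"
    unfolding ext_map_def by (rule sum.cong) (auto simp: ext_one_def)
  also have "\<dots> = ext_one T"
  proof (cases "T = {}")
    case True
    then have "{S. S \<subseteq> C \<and> inj_on h S \<and> h ` S = T} = {{}}" by auto
    then show ?thesis by simp
  next
    case False
    then show ?thesis by (intro sum.neutral[THEN trans]) (auto simp: ext_one_def)
  qed
  finally show "ext_map C h ext_one T = ext_one T" .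
qed

lemma wedge_gen_diff:
  assumes "finite C" "v \<in> ext_alg C"
  shows "wedge (gen a - gen b) v = left_mult a v - left_mult b v"
proof
  fix S
  have *: "(\<Sum>T\<in>Pow S. (- 1) ^ card {(t, u) \<in> T \<times> (S - T). u < t} * gen c T * v (S - T)) = left_mult c v S"
    for c
  proof (cases "finite S")
    case True
    have "(\<Sum>T\<in>Pow S. (- 1) ^ card {(t, u) \<in> T \<times> (S - T). u < t} * gen c T * v (S - T))
      = (\<Sum>T\<in>Pow S. if T = {c} then (- 1) ^ card {(t, u) \<in> {c} \<times> (S - {c}). u < t} * v (S - {c}) else 0)"
      by (rule sum.cong) (auto simp: gen_def)
    also have "\<dots> = (if c \<in> S then (- 1) ^ card {(t, u) \<in> {c} \<times> (S - {c}). u < t} * v (S - {c}) else 0)"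
      using True by (simp add: sum.delta)
    also have "{(t, u) \<in> {c} \<times> (S - {c}). u < t} = Pair c ` {s \<in> S. s < c}"
      by auto
    also have "card \<dots> = card {s \<in> S. s < c}"
      by (rule card_image) (auto simp: inj_on_def)
    finally show ?thesis by (simp add: left_mult_def)
  next
    case False
    \<comment> \<open>Sums over an infinite set are 0 by convention, so \<open>left_mult\<close> has
      to vanish at an infinite \<open>S\<close> as well; it does because \<open>v\<close> is
      supported on subsets of a finite set.\<close>
    then have "\<not> S - {c} \<subseteq> C" using assms(1) finite_subset[of "S - {c}" C] by auto
    then show ?thesis using False ext_algD[OF assms(2)] by (simp add: left_mult_def)
  qed
  show "wedge (gen a - gen b) v S = (left_mult a v - left_mult b v) S"
    unfolding wedge_def minus_apply *[symmetric] sum_subtractf[symmetric]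
    by (rule sum.cong) (auto simp: algebra_simps)
qed

text \<open>Repeated multiplication by generators turns the unit into every sorted product up to
  sign, and differences generate all integral combinations, including 0, negatives and sums. An
  identity between additive operators therefore needs checking only on the unit and on a product
  with one generator.\<close>

lemma ext_alg_induct [consumes 2, case_names one diff left_mult]:
  assumes C: "finite C" and v: "v \<in> ext_alg C"
    and one: "P ext_one"
    and diff: "\<And>v w. v \<in> ext_alg C \<Longrightarrow> w \<in> ext_alg C \<Longrightarrow> P v \<Longrightarrow> P w \<Longrightarrow> P (v - w)"
    and left: "\<And>a v. a \<in> C \<Longrightarrow> v \<in> ext_alg C \<Longrightarrow> P v \<Longrightarrow> P (left_mult a v)"
  shows "P v"
proof -
  define Q where "Q v \<longleftrightarrow> v \<in> ext_alg C \<and> P v" for v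
  have Q_diff: "Q (v - w)" if "Q v" "Q w" for v w
    using that diff ext_alg_diff unfolding Q_def by blast
  have Q_one: "Q ext_one" using one by (simp add: Q_def)
  have Q_0: "Q 0" using Q_diff[OF Q_one Q_one] by simp
  have Q_uminus: "Q (- v)" if "Q v" for v using Q_diff[OF Q_0 that] by simp
  have Q_add: "Q (v + w)" if "Q v" "Q w" for v w
    using Q_diff[OF that(1) Q_uminus[OF that(2)]] by simp
  define \<delta> :: "'a set \<Rightarrow> 'a set \<Rightarrow> int" where "\<delta> S = (\<lambda>T. if T = S then 1 else 0)" for S
  have \<delta>: "Q (\<delta> S)" if "finite S" "S \<subseteq> C" for S
    using that
  proof (induction S rule: finite_induct)
    case empty
    then show ?case using Q_one by (simp add: \<delta>_def ext_one_def)
  next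
    case (insert a S)
    then have Q: "Q (left_mult a (\<delta> S))"
      using left left_mult_in unfolding Q_def by blast
    let ?k = "card {s \<in> insert a S. s < a}"
    have "left_mult a (\<delta> S) = (\<lambda>T. (- 1) ^ ?k * \<delta> (insert a S) T)"
      using insert.hyps by (fastforce simp: left_mult_def \<delta>_def fun_eq_iff)
    then have "left_mult a (\<delta> S) = \<delta> (insert a S) \<or> left_mult a (\<delta> S) = - \<delta> (insert a S)"
      by (cases "even ?k") (auto simp: fun_eq_iff)
    then show ?case using Q Q_uminus[OF Q] by auto
  qed
  have scale: "Q (\<lambda>T. k * \<delta> S T)" if "S \<subseteq> C" for k S
  proof -
    have Q: "Q (\<delta> S)" using \<delta> that C finite_subset by blast
    show ?thesis
    proof (induction k rule: int_induct[where k = 0])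
      case base
      then show ?case using Q_0 by (simp add: zero_fun_def)
    next
      case (step1 i)
      have "(\<lambda>T. (i + 1) * \<delta> S T) = (\<lambda>T. i * \<delta> S T) + \<delta> S"
        by (auto simp: fun_eq_iff algebra_simps)
      then show ?case using Q_add step1 Q by simp
    next
      case (step2 i)
      have "(\<lambda>T. (i - 1) * \<delta> S T) = (\<lambda>T. i * \<delta> S T) - \<delta> S"
        by (auto simp: fun_eq_iff algebra_simps)
      then show ?case using Q_diff step2 Q by simp
    qed
  qed
  have sum: "Q (\<lambda>T. \<Sum>S\<in>\<S>. v S * \<delta> S T)" if "finite \<S>" "\<S> \<subseteq> Pow C" for \<S>
    using that
  proof (induction \<S> rule: finite_induct)
    case empty
    then show ?case using Q_0 by (simp add: zero_fun_def)
  next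
    case (insert S \<S>)
    have "(\<lambda>T. \<Sum>S\<in>insert S \<S>. v S * \<delta> S T) = (\<lambda>T. v S * \<delta> S T) + (\<lambda>T. \<Sum>S\<in>\<S>. v S * \<delta> S T)"
      using insert.hyps by (auto simp: fun_eq_iff)
    then show ?case using Q_add scale insert by simp
  qed
  have "(\<lambda>T. \<Sum>S\<in>Pow C. v S * \<delta> S T) = v"
  proof
    fix T
    have "(\<Sum>S\<in>Pow C. v S * \<delta> S T) = (\<Sum>S\<in>Pow C. if S = T then v T else 0)"
      by (rule sum.cong) (auto simp: \<delta>_def)
    then show "(\<Sum>S\<in>Pow C. v S * \<delta> S T) = v T"
      using C ext_algD[OF v] by (auto simp: sum.delta)
  qed
  then show ?thesis using sum[of "Pow C"] C by (simp add: Q_def)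
qed

section \<open>Anticommutation relations\<close>

lemma left_mult_anticomm:
  assumes "finite C" "v \<in> ext_alg C"
  shows "left_mult a (left_mult b v) = - left_mult b (left_mult a v)"
proof
  fix S
  show "left_mult a (left_mult b v) S = (- left_mult b (left_mult a v)) S"
  proof (cases "finite S \<and> a \<in> S \<and> b \<in> S \<and> a \<noteq> b")
    case True
    \<comment> \<open>Removing \<open>c\<close> lowers the position of \<open>d\<close> exactly when
      \<open>c < d\<close>. For two distinct generators this happens in exactly one of the two
      orders, hence the single sign.\<close>
    have *: "card {s \<in> S. s < d} = (if c < d then Suc (card {s \<in> S - {c}. s < d}) else card {s \<in> S - {c}. s < d})"
      if "c \<in> S" for c d
    proof (cases "c < d")
      case True
      then have "{s \<in> S. s < d} = insert c {s \<in> S - {c}. s < d}" using that by auto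
      then show ?thesis using True \<open>finite S \<and> _\<close> by (simp add: card_insert_if)
    next
      case False
      then have "{s \<in> S. s < d} = {s \<in> S - {c}. s < d}" by auto
      then show ?thesis using False by simp
    qed
    have ab: "a \<in> S" "b \<in> S" "a \<noteq> b" "S - {a} - {b} = S - {b} - {a}" using True by auto
    have "left_mult a (left_mult b v) S = (- 1) ^ card {s \<in> S. s < a}
        * ((- 1) ^ card {s \<in> S - {a}. s < b} * v (S - {a} - {b}))"
      and "left_mult b (left_mult a v) S = (- 1) ^ card {s \<in> S. s < b}
        * ((- 1) ^ card {s \<in> S - {b}. s < a} * v (S - {a} - {b}))"
      using ab by (simp_all add: left_mult_def)
    then show ?thesis
      unfolding *[OF ab(1), of b] *[OF ab(2), of a] uminus_apply
      using ab(3) by (cases "a < b") (auto dest: less_asym)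
  next
    case False
    have "v (S - {a} - {b}) = 0" "v (S - {b} - {a}) = 0" if "infinite S"
      using that assms(1) finite_subset[of "S - {a} - {b}" C] finite_subset[of "S - {b} - {a}" C]
      by (auto intro!: ext_algD[OF assms(2)])
    then show ?thesis using False by (auto simp: left_mult_def)
  qed
qed

lemma left_mult_same [simp]: "left_mult a (left_mult a v) = 0"
  by (auto simp: left_mult_def fun_eq_iff)

text \<open>Contraction is an antiderivation, and the functional has value 1 on \<open>a\<close>. On
  coefficients: if \<open>a\<close> is not in \<open>S\<close>, only the removal of \<open>a\<close>
  itself contributes; if it is, the removals of the other generators cancel in the sum of the two
  composites, and the removal of \<open>a\<close> leaves \<open>v S\<close>.\<close>

lemma contract_left_mult:
  assumes C: "finite C" and v: "v \<in> ext_alg C" and a: "a \<in> C"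
  shows "contract C (left_mult a v) = v - left_mult a (contract C v)"
proof
  fix S
  show "contract C (left_mult a v) S = (v - left_mult a (contract C v)) S"
  proof (cases "S \<subseteq> C")
    case False
    then show ?thesis
      using ext_algD[OF v] ext_algD[OF contract_in[OF left_mult_in[OF a v]]]
        ext_algD[OF left_mult_in[OF a contract_in[OF v]]] by simp
  next
    case S: True
    then have fin: "finite S" using C finite_subset by blast
    show ?thesis
    proof (cases "a \<in> S")
      case False
      have "contract C (left_mult a v) S
        = (\<Sum>b\<in>C - S. if b = a then (- 1) ^ card {s \<in> S. s < a} * left_mult a v (insert a S) else 0)"
        unfolding contract_def using False by (intro sum.cong) (auto simp: left_mult_def)
      also have "\<dots> = (- 1) ^ card {s \<in> S. s < a} * left_mult a v (insert a S)"
        using C a False by (simp add: sum.delta)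
      also have "{s \<in> insert a S. s < a} = {s \<in> S. s < a}" by auto
      then have "(- 1) ^ card {s \<in> S. s < a} * left_mult a v (insert a S) = v S"
        using False by (simp add: left_mult_def flip: power_add mult.assoc)
      finally show ?thesis using False by (simp add: left_mult_def)
    next
      case True
      define n where "n b = card {s \<in> S. s < b}" for b
      define n' where "n' b = card {s \<in> S - {a}. s < b}" for b
      have n: "n b = (if a < b then Suc (n' b) else n' b)" for b
      proof (cases "a < b")
        case True
        then have "{s \<in> S. s < b} = insert a {s \<in> S - {a}. s < b}" using \<open>a \<in> S\<close> by auto
        then show ?thesis using True fin by (simp add: n_def n'_def)
      next
        case False
        then have "{s \<in> S. s < b} = {s \<in> S - {a}. s < b}" by auto
        then show ?thesis using False by (simp add: n_def n'_def)
      qed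
      \<comment> \<open>Here \<open>a\<close> reenters the range of summation. Its summand
        contributes \<open>v S\<close>, the two signs being equal since
        \<open>n a = n' a\<close>.\<close>
      have "C - (S - {a}) = insert a (C - S)" using a by auto
      then have "left_mult a (contract C v) S = (- 1) ^ n a *
          ((- 1) ^ n' a * v S + (\<Sum>b\<in>C - S. (- 1) ^ n' b * v (insert b (S - {a}))))"
        using True C by (simp add: left_mult_def contract_def n_def n'_def insert_absorb)
      also have "\<dots> = v S + (\<Sum>b\<in>C - S. (- 1) ^ n a * ((- 1) ^ n' b * v (insert b (S - {a}))))"
        using n[of a] by (simp add: distrib_left sum_distrib_left flip: power_add mult.assoc)
      also have "(\<Sum>b\<in>C - S. (- 1) ^ n a * ((- 1) ^ n' b * v (insert b (S - {a}))))
        = - (\<Sum>b\<in>C - S. (- 1) ^ n b * left_mult a v (insert b S))"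
        unfolding sum_negf[symmetric]
      proof (rule sum.cong)
        fix b assume b: "b \<in> C - S"
        have *: "{s \<in> insert b S. s < a} = (if b < a then insert b {s \<in> S. s < a} else {s \<in> S. s < a})"
          by auto
        have "insert b S - {a} = insert b (S - {a})" "a \<noteq> b" using b True by auto
        moreover have "card {s \<in> insert b S. s < a} = (if b < a then Suc (n a) else n a)"
          unfolding * using b fin by (simp add: n_def)
        ultimately have "left_mult a v (insert b S)
            = (- 1) ^ (if b < a then Suc (n a) else n a) * v (insert b (S - {a}))"
          using True by (simp only: left_mult_def insert_iff simp_thms if_True)
        then show "(- 1) ^ n a * ((- 1) ^ n' b * v (insert b (S - {a})))
            = - ((- 1) ^ n b * left_mult a v (insert b S))"
          unfolding n[of b] using \<open>a \<noteq> b\<close> by (cases "a < b") (auto dest: less_asym)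
      qed simp
      finally show ?thesis by (simp add: contract_def n_def)
    qed
  qed
qed

text \<open>Two uses of the antiderivation rule on a product with \<open>a\<close> leave the product
  of \<open>a\<close> with the double contraction of the other factor, which vanishes by
  induction.\<close>

lemma contract_contract:
  assumes "finite C" "v \<in> ext_alg C"
  shows "contract C (contract C v) = 0"
  using assms
  by (induction v rule: ext_alg_induct)
    (simp_all add: contract_diff contract_left_mult contract_in assms(1) del: zero_fun_apply minus_apply)

lemma twist_left_mult:
  assumes "finite C" "v \<in> ext_alg C"
  shows "left_mult a (twist v) = - twist (left_mult a v)"
proof
  fix S
  show "left_mult a (twist v) S = (- twist (left_mult a v)) S"
  proof (cases "finite S")
    case True
    have "(- 1 :: int) ^ card S = - ((- 1) ^ card (S - {a}))" if "a \<in> S"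
      using card.remove[OF True that] by simp
    then show ?thesis by (simp add: left_mult_def twist_def del: card_Diff_insert)
  next
    case False
    then have "v (S - {a}) = 0"
      using assms(1) finite_subset[of "S - {a}" C] by (auto intro!: ext_algD[OF assms(2)])
    then show ?thesis by (simp add: left_mult_def twist_def)
  qed
qed

lemma twist_contract:
  assumes "finite C" "v \<in> ext_alg C"
  shows "contract C (twist v) = - twist (contract C v)"
proof
  fix S
  have "(- 1) ^ card {s \<in> S. s < b} * twist v (insert b S)
      = - ((- 1) ^ card S * ((- 1) ^ card {s \<in> S. s < b} * v (insert b S)))" if "b \<in> C - S" for b
  proof (cases "finite S")
    case True
    then show ?thesis using that by (simp add: twist_def)
  next
    case False
    then have "v (insert b S) = 0"
      using assms(1) finite_subset[of "insert b S" C] by (auto intro!: ext_algD[OF assms(2)])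
    then show ?thesis by (simp add: twist_def)
  qed
  then show "contract C (twist v) S = (- twist (contract C v)) S"
    unfolding uminus_apply twist_def[of "contract C v"]
    unfolding contract_def sum_distrib_left sum_negf[symmetric]
    by (intro sum.cong) auto
qed

section \<open>Induced maps and their kernels\<close>

lemma twist_ext_map: "ext_map C h (twist v) = twist (ext_map C h v)"
  unfolding ext_map_def twist_def fun_eq_iff sum_distrib_left
  by (auto intro!: sum.cong simp: card_image)

text \<open>Induced maps are multiplicative; for a sorted basis this is a statement about
  inversions. The sets \<open>S\<close> that contribute at \<open>T\<close> and contain
  \<open>a\<close> correspond to the sets \<open>S - {a}\<close> that contribute at
  \<open>T - {h a}\<close>, and the signs are compared by sorting the other elements according to
  their side of \<open>a\<close> and of \<open>h a\<close>.\<close>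

lemma ext_map_left_mult:
  assumes C: "finite C" and a: "a \<in> C"
  shows "ext_map C h (left_mult a v) = left_mult (h a) (ext_map C h v)"
proof
  fix T
  define \<S> where "\<S> T = {S. S \<subseteq> C \<and> inj_on h S \<and> h ` S = T}" for T
  define n where "n S = card {(a, b) \<in> S \<times> S. a < b \<and> h b < h a}" for S
  have fin: "finite (\<S> T)" for T
    unfolding \<S>_def using C by simp
  have em: "ext_map C h f T = (\<Sum>S\<in>\<S> T. (- 1) ^ n S * f S)" for f T
    by (simp add: ext_map_def \<S>_def n_def)
  have *: "(\<Sum>S\<in>\<S> T. (- 1) ^ n S * left_mult a v S)
      = (\<Sum>S\<in>{S \<in> \<S> T. a \<in> S}. (- 1) ^ n S * left_mult a v S)"
    using fin by (intro sum.mono_neutral_right) (auto simp: left_mult_def)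
  show "ext_map C h (left_mult a v) T = left_mult (h a) (ext_map C h v) T"
  proof (cases "h a \<in> T")
    case False
    then have "{S \<in> \<S> T. a \<in> S} = {}" by (auto simp: \<S>_def)
    then show ?thesis using False unfolding em * by (simp only: sum.empty) (simp add: left_mult_def)
  next
    case True
    have "(\<Sum>S\<in>{S \<in> \<S> T. a \<in> S}. (- 1) ^ n S * left_mult a v S)
      = (\<Sum>S\<in>\<S> (T - {h a}). (- 1) ^ card {t \<in> T. t < h a} * ((- 1) ^ n S * v S))"
    proof (rule sum.reindex_bij_witness[where i = "insert a" and j = "\<lambda>S. S - {a}"])
      fix S assume "S \<in> {S \<in> \<S> T. a \<in> S}"
      then have S: "S \<subseteq> C" "inj_on h S" "h ` S = T" "a \<in> S" by (auto simp: \<S>_def)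
      show "insert a (S - {a}) = S" using S by auto
      show "S - {a} \<in> \<S> (T - {h a})"
        using S by (auto simp: \<S>_def inj_on_def)
      define R where "R = S - {a}"
      have R: "finite R" "a \<notin> R" "S = insert a R"
        using S C finite_subset by (auto simp: R_def)
      \<comment> \<open>In the names below, the first letter records the position relative to
        \<open>a\<close> and the second that of the image relative to \<open>h a\<close>, with l for
        less and g for greater. The inversions involving \<open>a\<close> come from
        \<open>?lg\<close> and \<open>?gl\<close>.\<close>
      have neq: "h s \<noteq> h a" "s \<noteq> a" if "s \<in> R" for s
        using that S R by (auto simp: inj_on_def)
      let ?lg = "{s \<in> R. s < a \<and> h a < h s}"
      let ?gl = "{s \<in> R. a < s \<and> h s < h a}"
      let ?ll = "{s \<in> R. s < a \<and> h s < h a}"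
      let ?inv = "{(b, c) \<in> R \<times> R. b < c \<and> h c < h b}"
      let ?new = "(\<lambda>s. (s, a)) ` ?lg \<union> Pair a ` ?gl"
      have split: "{(b, c) \<in> S \<times> S. b < c \<and> h c < h b} = ?inv \<union> ?new"
        using R by auto
      have "finite ?inv"
        by (rule finite_subset[of _ "R \<times> R"]) (use R(1) in auto)
      moreover have "finite ?new" using R(1) by simp
      moreover have "?inv \<inter> ?new = {}" using R(2) by auto
      ultimately have card_inv: "card (?inv \<union> ?new) = n R + card ?new"
        unfolding n_def by (rule card_Un_disjoint)
      have "(\<lambda>s. (s, a)) ` ?lg \<inter> Pair a ` ?gl = {}" using R(2) by auto
      then have "card ?new = card ((\<lambda>s. (s, a)) ` ?lg) + card (Pair a ` ?gl)"
        using R(1) by (simp add: card_Un_disjoint)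
      then have card_new: "card ?new = card ?lg + card ?gl"
        by (simp add: card_image inj_on_def)
      have nS: "n S = n R + (card ?lg + card ?gl)"
        unfolding n_def[of S] split card_inv card_new ..
      have "{s \<in> S. s < a} = ?lg \<union> ?ll" using R neq by force
      moreover have "card (?lg \<union> ?ll) = card ?lg + card ?ll"
        using R(1) by (intro card_Un_disjoint) auto
      ultimately have sa: "card {s \<in> S. s < a} = card ?lg + card ?ll" by simp
      have "inj_on h (?ll \<union> ?gl)" using S(2) R(3) by (auto simp: inj_on_def)
      moreover have "{t \<in> T. t < h a} = h ` (?ll \<union> ?gl)"
      proof -
        have "{t \<in> T. t < h a} = h ` {s \<in> R. h s < h a}" using R(3) S(3) by auto
        moreover have "s < a \<or> a < s" if "s \<in> R" for s using neq(2)[OF that] by auto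
        then have "{s \<in> R. h s < h a} = ?ll \<union> ?gl" by blast
        ultimately show ?thesis by simp
      qed
      moreover have "card (?ll \<union> ?gl) = card ?ll + card ?gl"
        using R(1) by (intro card_Un_disjoint) auto
      ultimately have ta: "card {t \<in> T. t < h a} = card ?ll + card ?gl"
        by (simp only: card_image)
      \<comment> \<open>The exponents are \<open>n R + 2 * card ?lg + card ?gl + card ?ll\<close>
        and \<open>card ?ll + card ?gl + n R\<close>, so they have equal parity.\<close>
      have "(- 1 :: int) ^ (n S + card {s \<in> S. s < a}) = (- 1) ^ (card {t \<in> T. t < h a} + n R)"
        unfolding nS sa ta minus_one_power_iff even_add by argo
      then show "(- 1) ^ card {t \<in> T. t < h a} * ((- 1) ^ n (S - {a}) * v (S - {a}))
          = (- 1) ^ n S * left_mult a v S"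
        using S by (simp add: left_mult_def R_def power_add flip: mult.assoc)
    next
      fix S assume "S \<in> \<S> (T - {h a})"
      then have S: "S \<subseteq> C" "inj_on h S" "h ` S = T - {h a}" by (auto simp: \<S>_def)
      then have "a \<notin> S" by blast
      then show "insert a S - {a} = S" by simp
      have "h ` insert a S = T" using S True by auto
      then show "insert a S \<in> {S \<in> \<S> T. a \<in> S}"
        using S a \<open>a \<notin> S\<close> by (auto simp: \<S>_def)
    qed
    then show ?thesis
      using True unfolding em * by (simp add: left_mult_def[of "h a"] em sum_distrib_left)
  qed
qed

text \<open>Every generator on either side has value 1, so \<open>h\<close> pulls the functional on
  \<open>C'\<close> back to that on \<open>C\<close>; both composites then obey the same
  antiderivation rule.\<close>

lemma ext_map_contract:
  assumes C: "finite C" and h: "h ` C \<subseteq> C'" "finite C'" and v: "v \<in> ext_alg C"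
  shows "ext_map C h (contract C v) = contract C' (ext_map C h v)"
  using C v
proof (induction v rule: ext_alg_induct)
  case one
  show ?case by (simp del: zero_fun_apply)
next
  case (diff v w)
  then show ?case by (simp add: contract_diff ext_map_diff del: minus_apply)
next
  case (left_mult a v)
  then have "h a \<in> C'" using h by blast
  then show ?case
    using left_mult ext_map_in[OF h(1)]
    by (simp add: contract_left_mult ext_map_diff ext_map_left_mult C h(2) del: minus_apply)
qed

text \<open>Supplies the lifts over which the definition of a split map quantifies.\<close>

lemma ext_map_surj:
  assumes C: "finite C" and v: "v \<in> ext_alg (h ` C)"
  shows "\<exists>v'\<in>ext_alg C. ext_map C h v' = v"
  using finite_imageI[OF C] v
proof (induction v rule: ext_alg_induct)
  case one
  show ?case using ext_map_ext_one ext_one_in by blast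
next
  case (diff v w)
  then show ?case using ext_map_diff ext_alg_diff by metis
next
  case (left_mult a v)
  then show ?case using ext_map_left_mult[OF C] left_mult_in by (metis imageE)
qed

text \<open>When \<open>h\<close> identifies at most \<open>a1\<close> and \<open>a2\<close>, the
  kernel is the ideal generated by \<open>a1 - a2\<close>, which multiplication by
  \<open>a1 - a2\<close> kills. The proof avoids describing the kernel: replacing \<open>a2\<close>
  by \<open>a1\<close> throughout factors through \<open>ext_map C h\<close> and does not change the
  product with \<open>a1 - a2\<close>.\<close>

lemma ext_map_kernel:
  assumes C: "finite C" and a: "a1 \<in> C" "a2 \<in> C" "h a1 = h a2"
    and fibre: "\<And>c c'. c \<in> C \<Longrightarrow> c' \<in> C \<Longrightarrow> h c = h c' \<Longrightarrow> c = c' \<or> {c, c'} \<subseteq> {a1, a2}"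
    and v: "v \<in> ext_alg C" "ext_map C h v = 0"
  shows "left_mult a1 v = left_mult a2 v"
proof -
  \<comment> \<open>A section of \<open>h\<close> that chooses \<open>a1\<close> over the common
    image; \<open>E\<close> below is the substitution of \<open>a1\<close> for
    \<open>a2\<close>.\<close>
  define s where "s d = (if d = h a1 then a1 else inv_into C h d)" for d
  have s: "s (h c) = c" if "c \<in> C" "c \<noteq> a2" for c
    using fibre[of c a1] fibre[of c "inv_into C h (h c)"] that a
    by (auto simp: s_def inv_into_into f_inv_into_f)
  have s2: "s (h a2) = a1" using a by (simp add: s_def)
  have "s (h c) \<in> C" if "c \<in> C" for c
    using that s s2 a by (cases "c = a2") auto
  then have sC: "s ` h ` C \<subseteq> C" by blast
  define E where "E v = ext_map (h ` C) s (ext_map C h v)" for v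
  define \<Delta> where "\<Delta> w = left_mult a1 w - left_mult a2 w" for w
  have E_in: "E v \<in> ext_alg C" for v
    unfolding E_def by (rule ext_map_in[OF sC])
  have \<Delta>: "\<Delta> (left_mult c w) = - left_mult c (\<Delta> w)" if "w \<in> ext_alg C" for c w
    using left_mult_anticomm[OF C that, of a1 c] left_mult_anticomm[OF C that, of a2 c]
    by (simp add: \<Delta>_def left_mult_diff del: minus_apply)
  have "\<Delta> (E v) = \<Delta> v"
    using C v(1)
  proof (induction v rule: ext_alg_induct)
    case one
    show ?case by (simp add: E_def)
  next
    case (diff v w)
    have "E (v - w) = E v - E w" "\<And>v w. \<Delta> (v - w) = \<Delta> v - \<Delta> w"
      by (simp_all add: E_def \<Delta>_def ext_map_diff left_mult_diff del: minus_apply)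
    then show ?case using diff by (simp del: minus_apply)
  next
    case (left_mult c v)
    have "E (left_mult c v) = left_mult (s (h c)) (E v)"
      using left_mult C by (simp add: E_def ext_map_left_mult)
    then have *: "\<Delta> (E (left_mult c v)) = \<Delta> (left_mult (s (h c)) v)"
      using left_mult \<Delta> E_in by simp
    show ?case
    proof (cases "c = a2")
      case True
      \<comment> \<open>Both sides are the product of \<open>a1\<close>, \<open>a2\<close> and
        \<open>v\<close> in this order, since squares of generators vanish.\<close>
      have "\<Delta> (left_mult a1 v) = \<Delta> (left_mult a2 v)"
        using left_mult_anticomm[OF C left_mult(2), of a1 a2] by (simp add: \<Delta>_def)
      then show ?thesis using * True s2 by simp
    next
      case False
      then show ?thesis using * s left_mult by simp
    qed
  qed
  then have "\<Delta> v = 0" using v(2) by (simp add: E_def \<Delta>_def del: zero_fun_apply)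
  then show ?thesis by (simp add: \<Delta>_def)
qed

text \<open>
  The sign of \<open>twist\<close> compensates for split maps, which are multiplication by an element of degree 1,
  anticommuting with \<open>left_mult\<close> and \<open>contract\<close>; thus \<open>raise\<close> and \<open>lower\<close> commute with all edge maps.
\<close>

definition raise :: "'a::linorder \<Rightarrow> ('a set \<Rightarrow> int) \<Rightarrow> 'a set \<Rightarrow> int" where
  "raise a v = twist (left_mult a v)"

definition lower :: "'a::linorder set \<Rightarrow> ('a set \<Rightarrow> int) \<Rightarrow> 'a set \<Rightarrow> int" where
  "lower C v = - twist (contract C v)"

lemma raise_in: "a \<in> C \<Longrightarrow> v \<in> ext_alg C \<Longrightarrow> raise a v \<in> ext_alg C"
  by (simp add: raise_def left_mult_in twist_in)

lemma lower_in: "v \<in> ext_alg C \<Longrightarrow> lower C v \<in> ext_alg C"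
  by (simp add: lower_def contract_in twist_in ext_alg_uminus)

lemma raise_diff: "raise a (v - w) = raise a v - raise a w"
  by (simp add: raise_def left_mult_diff twist_diff del: minus_apply)

lemma lower_diff: "lower C (v - w) = lower C v - lower C w"
  by (simp add: lower_def contract_diff twist_diff del: minus_apply)

lemma lower_lower:
  assumes "finite C" "v \<in> ext_alg C"
  shows "lower C (lower C v) = 0"
  using assms contract_contract[OF assms] contract_in[OF assms(2)]
  by (simp add: lower_def contract_uminus twist_uminus twist_contract)

text \<open>Each composite contains two twists. Moving one past \<open>contract\<close> or
  \<open>left_mult\<close> costs a sign, which the minus in \<open>lower\<close> cancels, so the
  twists drop out and the antiderivation rule remains.\<close>

lemma lower_raise:
  assumes "finite C" "a \<in> C" "v \<in> ext_alg C"
  shows "lower C (raise a v) + raise a (lower C v) = v"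
proof -
  have "lower C (raise a v) = contract C (left_mult a v)"
    using assms by (simp add: lower_def raise_def twist_contract left_mult_in twist_uminus)
  moreover have "raise a (lower C v) = left_mult a (contract C v)"
    using assms by (simp add: lower_def raise_def left_mult_uminus twist_left_mult contract_in)
  ultimately show ?thesis using contract_left_mult[OF assms(1,3,2)] by simp
qed

lemma raise_sum: "raise a (\<lambda>S. \<Sum>e\<in>A. k e * f e S) = (\<lambda>S. \<Sum>e\<in>A. k e * raise a (f e) S)"
  by (auto simp: raise_def twist_def left_mult_def fun_eq_iff sum_distrib_left sum_distrib_right mult_ac)

lemma lower_sum: "lower C (\<lambda>S. \<Sum>e\<in>A. k e * f e S) = (\<lambda>S. \<Sum>e\<in>A. k e * lower C (f e) S)"
proof
  fix S
  show "lower C (\<lambda>S. \<Sum>e\<in>A. k e * f e S) S = (\<Sum>e\<in>A. k e * lower C (f e) S)"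
    unfolding lower_def twist_def contract_def uminus_apply sum_distrib_left sum_negf[symmetric]
    by (subst sum.swap) (auto intro!: sum.cong)
qed


section \<open>Circles of resolutions\<close>

lemma across_cases:
  assumes "i < 4"
  shows "across b i < 4" "across b (across b i) = i"
proof -
  have "i \<in> {0, 1, 2, 3}" using assms by auto
  then show "across b i < 4" "across b (across b i) = i"
    by (cases "even b"; auto simp: across_def)+
qed

locale finite_diagram =
  fixes D :: diagram
  assumes finite_edges: "finite (diagram_edges D)"
    and edges_nonempty: "diagram_edges D \<noteq> {}"
begin

lemma edge_at_in: "x \<in> crossings D \<Longrightarrow> i < 4 \<Longrightarrow> edge_at D x i \<in> diagram_edges D"
  by (force simp: diagram_edges_def corners_def label_def)

lemma joinedI:
  "x \<in> crossings D \<Longrightarrow> i < 4 \<Longrightarrow> (edge_at D x i, edge_at D x (across (I x) i)) \<in> joined D I"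
  unfolding joined_def by blast

lemma joined_sub: "joined D I \<subseteq> diagram_edges D \<times> diagram_edges D"
  using across_cases(1) by (auto simp: joined_def edge_at_in)

lemma sym_joined: "sym (joined D I)"
proof (rule symI)
  fix e e' assume "(e, e') \<in> joined D I"
  then obtain x i where x: "x \<in> crossings D" "i < 4" "e = edge_at D x i" "e' = edge_at D x (across (I x) i)"
    by (auto simp: joined_def)
  then show "(e', e) \<in> joined D I"
    using across_cases[OF x(2), of "I x"] unfolding joined_def by force
qed

lemma joined_sym: "(e, e') \<in> (joined D I)\<^sup>* \<Longrightarrow> (e', e) \<in> (joined D I)\<^sup>*"
  using sym_rtrancl[OF sym_joined] by (auto dest: symD)

lemma class_sub:
  assumes "e \<in> diagram_edges D"
  shows "(joined D I)\<^sup>* `` {e} \<subseteq> diagram_edges D"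
proof safe
  fix e' assume "(e, e') \<in> (joined D I)\<^sup>*"
  then show "e' \<in> diagram_edges D"
    by (cases rule: rtranclE) (use assms joined_sub in auto)
qed

lemma circle_of_rel:
  assumes "e \<in> diagram_edges D"
  shows "(e, circle_of D I e) \<in> (joined D I)\<^sup>*"
proof -
  have "Min ((joined D I)\<^sup>* `` {e}) \<in> (joined D I)\<^sup>* `` {e}"
    using class_sub[OF assms] finite_edges finite_subset by (intro Min_in) blast+
  then show ?thesis by (simp add: circle_of_def)
qed

lemma circle_of_eq_iff:
  assumes "e \<in> diagram_edges D" "e' \<in> diagram_edges D"
  shows "circle_of D I e = circle_of D I e' \<longleftrightarrow> (e, e') \<in> (joined D I)\<^sup>*"
proof
  assume "circle_of D I e = circle_of D I e'"
  then show "(e, e') \<in> (joined D I)\<^sup>*"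
    using circle_of_rel[OF assms(1), of I] circle_of_rel[OF assms(2), of I] joined_sym
    by (metis rtrancl_trans)
next
  assume "(e, e') \<in> (joined D I)\<^sup>*"
  then have "(joined D I)\<^sup>* `` {e} = (joined D I)\<^sup>* `` {e'}"
    using joined_sym by (auto intro: rtrancl_trans)
  then show "circle_of D I e = circle_of D I e'" by (simp add: circle_of_def)
qed

lemma circles_sub: "circles D I \<subseteq> diagram_edges D"
  using circle_of_rel class_sub unfolding circles_def by blast

lemma finite_circles: "finite (circles D I)"
  by (simp add: circles_def finite_edges)

lemma circle_of_in: "e \<in> diagram_edges D \<Longrightarrow> circle_of D I e \<in> circles D I"
  by (simp add: circles_def)

lemma circle_of_circle: "c \<in> circles D I \<Longrightarrow> circle_of D I c = c"
  using circle_of_rel circles_sub circle_of_eq_iff joined_sym unfolding circles_def by blast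

text \<open>Being the least edge, \<open>base\<close> represents the circle that contains it in every resolution.\<close>

definition base :: nat where
  "base = Min (diagram_edges D)"

lemma base_in_edges: "base \<in> diagram_edges D"
  unfolding base_def using finite_edges edges_nonempty by (rule Min_in)

lemma circle_of_base [simp]: "circle_of D I base = base"
  unfolding circle_of_def
proof (rule Min_eqI)
  have sub: "(joined D I)\<^sup>* `` {base} \<subseteq> diagram_edges D"
    using class_sub base_in_edges by blast
  then show "finite ((joined D I)\<^sup>* `` {base})" using finite_edges finite_subset by blast
  show "base \<le> e" if "e \<in> (joined D I)\<^sup>* `` {base}" for e
    using that sub finite_edges by (auto simp: base_def)
qed simp

lemma base_in_circles: "base \<in> circles D I"
  using circle_of_in[OF base_in_edges] by simp


section \<open>Edge maps commute with raising and lowering\<close>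

text \<open>All four corners at \<open>x\<close> lie on one circle of \<open>D(I)\<close>, so the
  strands of the 1-resolution at \<open>x\<close> stay within it: the circles of \<open>D(J)\<close>
  refine those of \<open>D(I)\<close>. Conversely, two different circles of \<open>D(J)\<close>
  inside one circle of \<open>D(I)\<close> can only be connected through \<open>x\<close>, and the
  corners there lie on the circles of corners 1 and 3.\<close>

lemma circle_of_refine:
  assumes x: "x \<in> crossings D" "I x = 0"
    and same: "circle_of D I (edge_at D x 0) = circle_of D I (edge_at D x 2)"
  defines "J \<equiv> I(x := 1)"
  defines "a \<equiv> \<lambda>i. circle_of D J (edge_at D x i)"
  shows "circle_of D I ` circles D J = circles D I"
    and "circle_of D I (a 1) = circle_of D I (a 3)"
    and "\<And>c c'. c \<in> circles D J \<Longrightarrow> c' \<in> circles D J \<Longrightarrow> circle_of D I c = circle_of D I c' \<Longrightarrow>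
           c = c' \<or> {c, c'} \<subseteq> {a 1, a 3}"
proof -
  define E where "E i = edge_at D x i" for i
  have E_in: "E i \<in> diagram_edges D" if "i < 4" for i
    using edge_at_in x that by (simp add: E_def)
  have i4: "i = 0 \<or> i = 1 \<or> i = 2 \<or> i = 3" if "i < 4" for i :: nat
    using that by auto
  have I_join: "(E i, E (across 0 i)) \<in> joined D I" and J_join: "(E i, E (across 1 i)) \<in> joined D J"
    if "i < 4" for i
    using joinedI[OF x(1) that, of I] joinedI[OF x(1) that, of J] x(2) by (simp_all add: E_def J_def)
  have "(E 0, E 1) \<in> joined D I" "(E 2, E 3) \<in> joined D I"
    using I_join[of 0] I_join[of 2] by (simp_all add: across_def)
  moreover have "(E 0, E 2) \<in> (joined D I)\<^sup>*"
    using same circle_of_eq_iff E_in by (simp add: E_def)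
  ultimately have "(E 0, E i) \<in> (joined D I)\<^sup>*" if "i < 4" for i
    using i4[OF that] by (auto intro: rtrancl_into_rtrancl)
  then have E_rel: "(E i, E j) \<in> (joined D I)\<^sup>*" if "i < 4" "j < 4" for i j
    using that joined_sym rtrancl_trans by metis
  have "joined D J \<subseteq> (joined D I)\<^sup>*"
  proof
    fix q assume "q \<in> joined D J"
    then obtain y i where y: "y \<in> crossings D" "i < 4"
        "q = (edge_at D y i, edge_at D y (across (J y) i))"
      by (auto simp: joined_def)
    show "q \<in> (joined D I)\<^sup>*"
    proof (cases "y = x")
      case True
      then show ?thesis using y E_rel across_cases(1) by (simp add: E_def)
    next
      case False
      then have "q \<in> joined D I" using y by (auto simp: joined_def J_def)
      then show ?thesis by auto
    qed
  qed
  then have J_sub: "(joined D J)\<^sup>* \<subseteq> (joined D I)\<^sup>*"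
    by (rule rtrancl_subset_rtrancl)
  have I_J: "circle_of D I (circle_of D J e) = circle_of D I e" if "e \<in> diagram_edges D" for e
    using circle_of_rel[OF that, of J] J_sub circle_of_eq_iff circles_sub circle_of_in that joined_sym
    by blast
  then show "circle_of D I ` circles D J = circles D I"
    by (simp add: circles_def image_image)
  show "circle_of D I (a 1) = circle_of D I (a 3)"
    using I_J E_in E_rel circle_of_eq_iff by (simp add: a_def E_def)
  \<comment> \<open>The edges on circles of \<open>D(J)\<close> that pass through \<open>x\<close>:
    corner 2 is joined to corner 1, and corner 0 to corner 3.\<close>
  define A where "A = {e. (e, E 1) \<in> (joined D J)\<^sup>* \<or> (e, E 3) \<in> (joined D J)\<^sup>*}"
  have "(E 2, E 1) \<in> joined D J" "(E 0, E 3) \<in> joined D J"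
    using J_join[of 2] J_join[of 0] by (simp_all add: across_def)
  then have A_E: "E i \<in> A" if "i < 4" for i
    using i4[OF that] by (auto simp: A_def)
  have A_closed: "e \<in> A" if "(e, e') \<in> (joined D J)\<^sup>*" "e' \<in> A" for e e'
    using that by (auto simp: A_def intro: rtrancl_trans)
  \<comment> \<open>Each step of a path in \<open>D(I)\<close> either is a step in
    \<open>D(J)\<close> or is at \<open>x\<close> and has both ends in \<open>A\<close>. As
    \<open>A\<close> is a union of classes of \<open>D(J)\<close>, one visit to \<open>x\<close>
    puts both end points of the path into \<open>A\<close>.\<close>
  have key: "(e, e') \<in> (joined D J)\<^sup>* \<or> e \<in> A \<and> e' \<in> A" if "(e, e') \<in> (joined D I)\<^sup>*" for e e'
    using that
  proof (induction rule: rtrancl_induct)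
    case base
    then show ?case by simp
  next
    case (step e' e'')
    from step(2) obtain y i where y: "y \<in> crossings D" "i < 4"
        "e' = edge_at D y i" "e'' = edge_at D y (across (I y) i)"
      by (auto simp: joined_def)
    show ?case
    proof (cases "y = x")
      case True
      then have "e' \<in> A" "e'' \<in> A" using y A_E across_cases(1) by (auto simp: E_def)
      then show ?thesis using step(3) A_closed by blast
    next
      case False
      then have *: "(e', e'') \<in> joined D J" using y by (auto simp: joined_def J_def)
      then have "(e'', e') \<in> (joined D J)\<^sup>*" using joined_sym by blast
      then show ?thesis using step(3) A_closed * by (meson rtrancl_into_rtrancl)
    qed
  qed
  have A_a: "c \<in> {a 1, a 3}" if "c \<in> circles D J" "c \<in> A" for c
  proof -
    have "circle_of D J c = a 1 \<or> circle_of D J c = a 3"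
      using that circles_sub[of J] circle_of_eq_iff[of c "E 1" J] circle_of_eq_iff[of c "E 3" J]
        E_in[of 1] E_in[of 3] by (auto simp: A_def a_def E_def)
    then show ?thesis using circle_of_circle that by simp
  qed
  fix c c' assume c: "c \<in> circles D J" "c' \<in> circles D J" "circle_of D I c = circle_of D I c'"
  then have "(c, c') \<in> (joined D I)\<^sup>*" using circle_of_eq_iff circles_sub by blast
  then have "(c, c') \<in> (joined D J)\<^sup>* \<or> c \<in> A \<and> c' \<in> A" by (rule key)
  then show "c = c' \<or> {c, c'} \<subseteq> {a 1, a 3}"
  proof
    assume "(c, c') \<in> (joined D J)\<^sup>*"
    then have "circle_of D J c = circle_of D J c'" using c circle_of_eq_iff circles_sub by blast
    then show ?thesis using c circle_of_circle by simp
  next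
    assume "c \<in> A \<and> c' \<in> A"
    then show ?thesis using A_a c by blast
  qed
qed

text \<open>The definite description of a split map becomes a formula on lifts. It denotes because
  two lifts of the same element differ by an element of the kernel of the quotient map, whose
  product with \<open>a1 - a2\<close> is 0.\<close>

lemma edge_map_cases:
  assumes "(I, x) \<in> cube_edges D"
  defines "J \<equiv> I(x := 1)"
  obtains (merge) "edge_map D arr I x = ext_map (circles D I) (circle_of D J)"
  | (split) a1 a2 where "a1 \<in> circles D J" "a2 \<in> circles D J"
      "circle_of D I ` circles D J = circles D I"
      "\<And>v. v \<in> ext_alg (circles D J) \<Longrightarrow>
         edge_map D arr I x (ext_map (circles D J) (circle_of D I) v) = left_mult a1 v - left_mult a2 v"
proof (cases "circle_of D I (edge_at D x 0) = circle_of D I (edge_at D x 2)")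
  case False
  then have "edge_map D arr I x = ext_map (circles D I) (circle_of D J)"
    by (simp add: fun_eq_iff edge_map_def J_def)
  then show ?thesis by (rule merge)
next
  case True
  let ?C = "circles D J" and ?h = "circle_of D I"
  have x: "x \<in> crossings D" "I x = 0" using assms(1) by (auto simp: cube_edges_def)
  note refine = circle_of_refine[OF x True, folded J_def]
  define a1 where "a1 = circle_of D J (edge_at D x (tail_corner arr x + 1))"
  define a2 where "a2 = circle_of D J (edge_at D x (head_corner arr x + 1))"
  have a: "a1 \<in> ?C" "a2 \<in> ?C"
    using x by (auto simp: a1_def a2_def tail_corner_def head_corner_def intro!: circle_of_in edge_at_in)
  \<comment> \<open>The arrow only decides which of the strands at corners 1 and 3 carries the tail
    of the rotated arrow.\<close>
  have pair: "(a1 = circle_of D J (edge_at D x 1) \<and> a2 = circle_of D J (edge_at D x 3)) \<or>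
      (a1 = circle_of D J (edge_at D x 3) \<and> a2 = circle_of D J (edge_at D x 1))"
    by (simp add: a1_def a2_def tail_corner_def head_corner_def numeral_3_eq_3)
  have h12: "?h a1 = ?h a2" using pair refine(2) by auto
  have fibre: "c = c' \<or> {c, c'} \<subseteq> {a1, a2}" if "c \<in> ?C" "c' \<in> ?C" "?h c = ?h c'" for c c'
    using refine(3)[OF that] pair by auto
  have "edge_map D arr I x (ext_map ?C ?h v) = left_mult a1 v - left_mult a2 v"
    if v: "v \<in> ext_alg ?C" for v
  proof -
    have uniq: "left_mult a1 v' - left_mult a2 v' = left_mult a1 v - left_mult a2 v"
      if "v' \<in> ext_alg ?C" "ext_map ?C ?h v' = ext_map ?C ?h v" for v'
    proof -
      have "left_mult a1 (v' - v) = left_mult a2 (v' - v)"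
        using that v by (intro ext_map_kernel[OF finite_circles a h12 fibre])
          (simp_all add: ext_alg_diff ext_map_diff del: minus_apply)
      then show ?thesis by (simp add: left_mult_diff algebra_simps del: minus_apply)
    qed
    have "edge_map D arr I x (ext_map ?C ?h v) = (THE w. \<exists>v'\<in>ext_alg ?C.
        ext_map ?C ?h v' = ext_map ?C ?h v \<and> w = wedge (gen a1 - gen a2) v')"
      using True by (simp add: edge_map_def Let_def J_def a1_def a2_def True)
    also have "\<dots> = left_mult a1 v - left_mult a2 v"
      using v uniq wedge_gen_diff[OF finite_circles] by (intro the_equality) metis+
    finally show ?thesis .
  qed
  then show ?thesis using split a refine(1) by blast
qed

text \<open>A merge is an induced map that fixes the base circle, so it commutes with
  \<open>left_mult base\<close>, with contraction and with the twist separately. A split is, on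
  lifts, the product with \<open>a1 - a2\<close>, which anticommutes with each of the three;
  \<open>raise\<close> and \<open>lower\<close> combine the twist with one of the others, so two
  signs cancel.\<close>

lemma edge_map_props:
  assumes e: "(I, x) \<in> cube_edges D" and v: "v \<in> ext_alg (circles D I)"
  defines "J \<equiv> I(x := 1)"
  shows edge_map_in: "edge_map D arr I x v \<in> ext_alg (circles D J)"
    and edge_map_raise: "edge_map D arr I x (raise base v) = raise base (edge_map D arr I x v)"
    and edge_map_lower: "edge_map D arr I x (lower (circles D I) v)
      = lower (circles D J) (edge_map D arr I x v)"
    and edge_map_diff: "\<And>w. w \<in> ext_alg (circles D I) \<Longrightarrow>
      edge_map D arr I x (v - w) = edge_map D arr I x v - edge_map D arr I x w"
proof -
  let ?F = "edge_map D arr I x" and ?C = "circles D I" and ?C' = "circles D J"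
  note fin = finite_circles[of I] finite_circles[of J]
  have "?F v \<in> ext_alg ?C' \<and> ?F (raise base v) = raise base (?F v) \<and>
      ?F (lower ?C v) = lower ?C' (?F v) \<and>
      (\<forall>w \<in> ext_alg ?C. ?F (v - w) = ?F v - ?F w)"
    using e
  proof (cases rule: edge_map_cases[where arr = arr])
    case merge
    note F = merge[folded J_def]
    have h: "circle_of D J ` ?C \<subseteq> ?C'"
      using circles_sub circle_of_in by blast
    show ?thesis
      unfolding F
      using ext_map_in[OF h] ext_map_left_mult[OF fin(1) base_in_circles, of "circle_of D J"]
        ext_map_contract[OF fin(1) h fin(2) v]
      by (simp add: raise_def lower_def twist_ext_map ext_map_diff ext_map_uminus del: minus_apply)
  next
    case (split a1 a2)
    note split = split[folded J_def]
    define \<Delta> where "\<Delta> v = left_mult a1 v - left_mult a2 v" for v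
    let ?E = "ext_map ?C' (circle_of D I)"
    have F: "?F (?E v) = \<Delta> v" if "v \<in> ext_alg ?C'" for v
      using split(4)[OF that] by (simp add: \<Delta>_def)
    obtain v' where v': "v' \<in> ext_alg ?C'" "?E v' = v"
      using ext_map_surj[OF fin(2), of v "circle_of D I"] v split(3) by auto
    have \<Delta>_twist: "\<Delta> (twist u) = - twist (\<Delta> u)" if "u \<in> ext_alg ?C'" for u
      using twist_left_mult[OF fin(2) that] by (simp add: \<Delta>_def twist_diff del: minus_apply)
    have "?F v \<in> ext_alg ?C'"
      using F[OF v'(1)] v' split by (simp add: \<Delta>_def left_mult_in ext_alg_diff)
    moreover have "?F (raise base v) = raise base (?F v)"
    proof -
      have "raise base v = ?E (raise base v')"
        using ext_map_left_mult[OF fin(2) base_in_circles, of "circle_of D I"] v'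
        by (simp add: raise_def twist_ext_map)
      then have "?F (raise base v) = \<Delta> (raise base v')"
        using F raise_in[OF base_in_circles v'(1)] by simp
      also have "\<dots> = - twist (\<Delta> (left_mult base v'))"
        unfolding raise_def using \<Delta>_twist left_mult_in[OF base_in_circles v'(1)] by blast
      also have "\<Delta> (left_mult base v') = - left_mult base (\<Delta> v')"
        using left_mult_anticomm[OF fin(2) v'(1), of a1 base]
          left_mult_anticomm[OF fin(2) v'(1), of a2 base]
        by (simp add: \<Delta>_def left_mult_diff del: minus_apply)
      finally show ?thesis using F[OF v'(1)] v'(2) by (simp add: raise_def twist_uminus del: uminus_apply)
    qed
    moreover have "?F (lower ?C v) = lower ?C' (?F v)"
    proof -
      have "lower ?C v = ?E (lower ?C' v')"
        using ext_map_contract[OF fin(2) _ fin(1) v'(1), of "circle_of D I"] v' split(3)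
        by (simp add: lower_def twist_ext_map ext_map_uminus)
      then have "?F (lower ?C v) = \<Delta> (lower ?C' v')"
        using F lower_in[OF v'(1)] by simp
      also have "\<dots> = twist (\<Delta> (contract ?C' v'))"
        unfolding lower_def using \<Delta>_twist[OF contract_in[OF v'(1)]]
        by (simp add: \<Delta>_def left_mult_uminus algebra_simps del: minus_apply)
      \<comment> \<open>The functional has value 1 on both \<open>a1\<close> and \<open>a2\<close>,
        so the two terms \<open>v'\<close> produced by the antiderivation rule cancel.\<close>
      also have "\<Delta> (contract ?C' v') = - contract ?C' (\<Delta> v')"
        using v' split by (simp add: \<Delta>_def contract_diff contract_left_mult fin del: minus_apply)
      finally show ?thesis using F[OF v'(1)] v'(2) by (simp add: lower_def twist_uminus del: uminus_apply)
    qed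
    moreover have "?F (v - w) = ?F v - ?F w" if w: "w \<in> ext_alg ?C" for w
    proof -
      obtain w' where w': "w' \<in> ext_alg ?C'" "?E w' = w"
        using ext_map_surj[OF fin(2), of w "circle_of D I"] w split(3) by auto
      have "?F (?E (v' - w')) = ?F (?E v') - ?F (?E w')"
        unfolding F[OF v'(1)] F[OF w'(1)] F[OF ext_alg_diff[OF v'(1) w'(1)]]
        by (simp add: \<Delta>_def left_mult_diff algebra_simps del: minus_apply)
      then show ?thesis using v' w' by (simp add: ext_map_diff del: minus_apply)
    qed
    ultimately show ?thesis by blast
  qed
  then show "?F v \<in> ext_alg ?C'" "?F (raise base v) = raise base (?F v)"
      "?F (lower ?C v) = lower ?C' (?F v)"
      "\<And>w. w \<in> ext_alg ?C \<Longrightarrow> ?F (v - w) = ?F v - ?F w"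
    by blast+
qed


section \<open>The reduced complex\<close>

text \<open>Families without conditions on bidegree, on which the operator identities are stated;
  how the operators shift degrees is established separately.\<close>

definition chains :: "chain set" where
  "chains = {c. \<forall>I. c I \<in> ext_alg (circles D I)}"

definition chain_raise :: "chain \<Rightarrow> chain" where
  "chain_raise c = (\<lambda>I. raise base (c I))"

definition chain_lower :: "chain \<Rightarrow> chain" where
  "chain_lower c = (\<lambda>I. lower (circles D I) (c I))"

lemma chains_diff: "c \<in> chains \<Longrightarrow> c' \<in> chains \<Longrightarrow> c - c' \<in> chains"
  by (simp add: chains_def ext_alg_diff)

lemma chain_raise_in: "c \<in> chains \<Longrightarrow> chain_raise c \<in> chains"
  by (simp add: chains_def chain_raise_def raise_in base_in_circles)

lemma chain_raise_diff: "chain_raise (c - c') = chain_raise c - chain_raise c'"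
  by (rule ext) (simp add: chain_raise_def raise_diff)

lemma chain_lower_diff: "chain_lower (c - c') = chain_lower c - chain_lower c'"
  by (rule ext) (simp add: chain_lower_def lower_diff)

lemma chain_lower_lower: "c \<in> chains \<Longrightarrow> chain_lower (chain_lower c) = 0"
  by (rule ext) (simp add: chain_lower_def chains_def lower_lower finite_circles)

lemma chain_lower_raise:
  "c \<in> chains \<Longrightarrow> chain_lower (chain_raise c) + chain_raise (chain_lower c) = c"
  by (rule ext)
    (simp add: chain_lower_def chain_raise_def chains_def lower_raise finite_circles base_in_circles)

lemma boundary_apply:
  "boundary D arr \<epsilon> c J = (\<lambda>S. \<Sum>e | e \<in> cube_edges D \<and> (fst e)(snd e := 1) = J.
     \<epsilon> e * edge_map D arr (fst e) (snd e) (c (fst e)) S)"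
  by (simp add: boundary_def case_prod_unfold)

lemma boundary_in:
  assumes "c \<in> chains"
  shows "boundary D arr \<epsilon> c \<in> chains"
proof -
  have "boundary D arr \<epsilon> c J S = 0" if "\<not> S \<subseteq> circles D J" for J S
    unfolding boundary_apply
  proof (rule sum.neutral, safe)
    fix I x assume "(I, x) \<in> cube_edges D" "J = (fst (I, x))(snd (I, x) := 1)"
    then have "edge_map D arr I x (c I) S = 0"
      using edge_map_in[of I x "c I" arr] assms that by (auto simp: chains_def dest: ext_algD)
    then show "\<epsilon> (I, x) * edge_map D arr (fst (I, x)) (snd (I, x)) (c (fst (I, x))) S = 0" by simp
  qed
  then show ?thesis by (auto simp: chains_def intro!: ext_algI)
qed

lemma boundary_diff:
  assumes "c \<in> chains" "c' \<in> chains"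
  shows "boundary D arr \<epsilon> (c - c') = boundary D arr \<epsilon> c - boundary D arr \<epsilon> c'"
proof -
  have "edge_map D arr (fst e) (snd e) (c (fst e) - c' (fst e)) =
      edge_map D arr (fst e) (snd e) (c (fst e)) - edge_map D arr (fst e) (snd e) (c' (fst e))"
    if "e \<in> cube_edges D" for e
    using edge_map_diff[of "fst e" "snd e" "c (fst e)" "c' (fst e)"] that assms
    by (simp add: chains_def del: minus_apply)
  then show ?thesis
    by (auto simp: boundary_apply right_diff_distrib sum_subtractf[symmetric] intro!: ext sum.cong)
qed

lemma boundary_raise:
  assumes "c \<in> chains"
  shows "boundary D arr \<epsilon> (chain_raise c) = chain_raise (boundary D arr \<epsilon> c)"
proof
  fix J
  show "boundary D arr \<epsilon> (chain_raise c) J = chain_raise (boundary D arr \<epsilon> c) J"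
    unfolding chain_raise_def boundary_apply raise_sum
    using assms edge_map_raise
    by (intro ext sum.cong refl) (auto simp: chains_def)
qed

lemma boundary_lower:
  assumes "c \<in> chains"
  shows "boundary D arr \<epsilon> (chain_lower c) = chain_lower (boundary D arr \<epsilon> c)"
proof
  fix J
  show "boundary D arr \<epsilon> (chain_lower c) J = chain_lower (boundary D arr \<epsilon> c) J"
    unfolding chain_lower_def boundary_apply lower_sum
    using assms edge_map_lower
    by (intro ext sum.cong refl) (auto simp: chains_def)
qed

section \<open>Bidegrees of chains\<close>

lemma carrier_chain_groupD:
  "c \<in> carrier (chain_group D m s) \<Longrightarrow> c I S \<noteq> 0 \<Longrightarrow>
     I \<in> vertices D \<and> S \<subseteq> circles D I \<and> hom_degree D I = m \<and> q_degree D I (card S) = s"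
  by (simp add: chain_group_def)

lemma carrier_chain_group_sub: "carrier (chain_group D m s) \<subseteq> chains"
  using carrier_chain_groupD by (force simp: chains_def ext_alg_def)

lemma carrier_chain_group_diff:
  "c \<in> carrier (chain_group D m s) \<Longrightarrow> c' \<in> carrier (chain_group D m s) \<Longrightarrow>
     c - c' \<in> carrier (chain_group D m s)"
  unfolding chain_group_def by simp (metis diff_0_right)

lemma carrier_chain_group_0: "0 \<in> carrier (chain_group D m s)"
  by (simp add: chain_group_def)

text \<open>Multiplication by the base circle raises the exterior degree \<open>r\<close> by 1 at a
  fixed vertex, and \<open>r\<close> enters the q-grading with coefficient -2.\<close>

lemma chain_raise_degree:
  assumes "c \<in> carrier (chain_group D m s)" "s = s' + 2"
  shows "chain_raise c \<in> carrier (chain_group D m s')"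
proof -
  have "I \<in> vertices D \<and> S \<subseteq> circles D I \<and> hom_degree D I = m \<and> q_degree D I (card S) = s'"
    if "chain_raise c I S \<noteq> 0" for I S
  proof -
    have S: "base \<in> S" "c I (S - {base}) \<noteq> 0"
      using that by (auto simp: chain_raise_def raise_def twist_def left_mult_def split: if_splits)
    then have c: "I \<in> vertices D" "S - {base} \<subseteq> circles D I" "hom_degree D I = m"
        "q_degree D I (card (S - {base})) = s"
      using carrier_chain_groupD[OF assms(1)] by blast+
    have sub: "S \<subseteq> circles D I" using c(2) base_in_circles by blast
    then have "card S = Suc (card (S - {base}))"
      using S(1) finite_circles finite_subset by (metis card.remove)
    then have "q_degree D I (card S) = s'"
      using c(4) assms(2) by (simp only: q_degree_def) simp
    then show ?thesis using c sub by simp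
  qed
  then show ?thesis by (simp add: chain_group_def)
qed

lemma chain_lower_degree:
  assumes "c \<in> carrier (chain_group D m s)" "s' = s + 2"
  shows "chain_lower c \<in> carrier (chain_group D m s')"
proof -
  have "I \<in> vertices D \<and> S \<subseteq> circles D I \<and> hom_degree D I = m \<and> q_degree D I (card S) = s'"
    if "chain_lower c I S \<noteq> 0" for I S
  proof -
    have "contract (circles D I) (c I) S \<noteq> 0"
      using that by (auto simp: chain_lower_def lower_def twist_def)
    then obtain b where b: "b \<in> circles D I - S" "c I (insert b S) \<noteq> 0"
      unfolding contract_def by (metis (no_types, lifting) mult_zero_right sum.neutral)
    then have c: "I \<in> vertices D" "insert b S \<subseteq> circles D I" "hom_degree D I = m"
        "q_degree D I (card (insert b S)) = s"
      using carrier_chain_groupD[OF assms(1)] by blast+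
    have "finite S" using c(2) finite_circles finite_subset by (metis insert_subset)
    then have "card (insert b S) = Suc (card S)" using b by simp
    then have "q_degree D I (card S) = s'"
      using c(4) assms(2) by (simp only: q_degree_def) simp
    then show ?thesis using c by simp
  qed
  then show ?thesis by (simp add: chain_group_def)
qed

end


section \<open>Quotients of subgroups\<close>

definition add_subgroup :: "'a::ab_group_add set \<Rightarrow> bool" where
  "add_subgroup H \<longleftrightarrow> 0 \<in> H \<and> (\<forall>x\<in>H. \<forall>y\<in>H. x - y \<in> H)"

lemma add_subgroupD:
  assumes "add_subgroup H"
  shows "0 \<in> H" "x \<in> H \<Longrightarrow> y \<in> H \<Longrightarrow> x - y \<in> H" "x \<in> H \<Longrightarrow> - x \<in> H"
    "x \<in> H \<Longrightarrow> y \<in> H \<Longrightarrow> x + y \<in> H"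
proof -
  show 0: "0 \<in> H" and diff: "x \<in> H \<Longrightarrow> y \<in> H \<Longrightarrow> x - y \<in> H" for x y
    using assms by (auto simp: add_subgroup_def)
  show uminus: "x \<in> H \<Longrightarrow> - x \<in> H" for x using diff[OF 0] by simp
  show "x \<in> H \<Longrightarrow> y \<in> H \<Longrightarrow> x + y \<in> H" using diff[OF _ uminus] by force
qed

text \<open>\<open>B\<close> need not lie in \<open>Z\<close>: the elements of \<open>subquotient Z B\<close> are the cosets of \<open>B\<close> that meet \<open>Z\<close>.\<close>

definition subquotient :: "'a::ab_group_add set \<Rightarrow> 'a set \<Rightarrow> 'a set monoid" where
  "subquotient Z B = \<lparr>carrier = Z, monoid.mult = (+), one = 0\<rparr> Mod B"

definition add_coset :: "'a::ab_group_add set \<Rightarrow> 'a \<Rightarrow> 'a set" where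
  "add_coset B z = (\<lambda>b. b + z) ` B"

lemma carrier_subquotient: "carrier (subquotient Z B) = add_coset B ` Z"
  by (auto simp: subquotient_def FactGroup_def RCOSETS_def r_coset_def add_coset_def)

lemma one_subquotient: "\<one>\<^bsub>subquotient Z B\<^esub> = B"
  by (simp add: subquotient_def FactGroup_def)

lemma add_coset_0: "add_coset B 0 = B"
  by (simp add: add_coset_def)

lemma add_coset_eq_iff:
  assumes "add_subgroup B"
  shows "add_coset B z = add_coset B w \<longleftrightarrow> z - w \<in> B"
proof
  assume "add_coset B z = add_coset B w"
  moreover have "z \<in> add_coset B z"
    using add_subgroupD(1)[OF assms] by (force simp: add_coset_def)
  ultimately obtain b where "b \<in> B" "z = b + w" by (auto simp: add_coset_def)
  then show "z - w \<in> B" by simp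
next
  have sub: "add_coset B z \<subseteq> add_coset B w" if "z - w \<in> B" for z w
  proof
    fix y assume "y \<in> add_coset B z"
    then obtain b where "b \<in> B" "y = b + z" by (auto simp: add_coset_def)
    then have "y = (b + (z - w)) + w" "b + (z - w) \<in> B"
      using that add_subgroupD(4)[OF assms] by auto
    then show "y \<in> add_coset B w" unfolding add_coset_def by blast
  qed
  assume "z - w \<in> B"
  moreover from add_subgroupD(3)[OF assms this] have "w - z \<in> B" by simp
  ultimately show "add_coset B z = add_coset B w" using sub by blast
qed

lemma mult_subquotient:
  assumes "add_subgroup B"
  shows "add_coset B z \<otimes>\<^bsub>subquotient Z B\<^esub> add_coset B w = add_coset B (z + w)"
proof -
  have "add_coset B z \<otimes>\<^bsub>subquotient Z B\<^esub> add_coset B w = {(b + z) + (b' + w) | b b'. b \<in> B \<and> b' \<in> B}"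
    by (auto simp: subquotient_def FactGroup_def set_mult_def add_coset_def)
  also have "\<dots> = add_coset B (z + w)"
  proof safe
    fix b b' assume "b \<in> B" "b' \<in> B"
    then have "b + b' \<in> B" by (rule add_subgroupD(4)[OF assms])
    then show "(b + z) + (b' + w) \<in> add_coset B (z + w)"
      unfolding add_coset_def by (rule rev_image_eqI) (simp add: algebra_simps)
  next
    fix y assume "y \<in> add_coset B (z + w)"
    then obtain b where "b \<in> B" "y = (b + z) + (0 + w)" by (auto simp: add_coset_def algebra_simps)
    then show "\<exists>b b'. y = (b + z) + (b' + w) \<and> b \<in> B \<and> b' \<in> B"
      using add_subgroupD(1)[OF assms] by blast
  qed
  finally show ?thesis .
qed

lemma comm_group_subquotient:
  assumes Z: "add_subgroup Z" and B: "add_subgroup B"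
  shows "comm_group (subquotient Z B)"
proof (rule comm_groupI)
  show "\<one>\<^bsub>subquotient Z B\<^esub> \<in> carrier (subquotient Z B)"
    using add_subgroupD(1)[OF Z] add_coset_0[of B] by (force simp: one_subquotient carrier_subquotient)
  fix X assume "X \<in> carrier (subquotient Z B)"
  then obtain x where x: "x \<in> Z" "X = add_coset B x" by (auto simp: carrier_subquotient)
  show "\<one>\<^bsub>subquotient Z B\<^esub> \<otimes>\<^bsub>subquotient Z B\<^esub> X = X"
    using mult_subquotient[OF B, where z = 0 and w = x] x by (simp add: one_subquotient add_coset_0)
  have "add_coset B (- x) \<otimes>\<^bsub>subquotient Z B\<^esub> X = \<one>\<^bsub>subquotient Z B\<^esub>"
    using mult_subquotient[OF B, where z = "- x" and w = x] x by (simp add: one_subquotient add_coset_0)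
  then show "\<exists>Y\<in>carrier (subquotient Z B). Y \<otimes>\<^bsub>subquotient Z B\<^esub> X = \<one>\<^bsub>subquotient Z B\<^esub>"
    using x add_subgroupD(3)[OF Z] by (auto simp: carrier_subquotient)
  fix Y assume "Y \<in> carrier (subquotient Z B)"
  then obtain y where y: "y \<in> Z" "Y = add_coset B y" by (auto simp: carrier_subquotient)
  show "X \<otimes>\<^bsub>subquotient Z B\<^esub> Y \<in> carrier (subquotient Z B)"
    using x y add_subgroupD(4)[OF Z] by (auto simp: carrier_subquotient mult_subquotient[OF B])
  show "X \<otimes>\<^bsub>subquotient Z B\<^esub> Y = Y \<otimes>\<^bsub>subquotient Z B\<^esub> X"
    using x y by (simp add: mult_subquotient[OF B] add.commute)
  fix W assume "W \<in> carrier (subquotient Z B)"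
  then obtain w where w: "w \<in> Z" "W = add_coset B w" by (auto simp: carrier_subquotient)
  show "X \<otimes>\<^bsub>subquotient Z B\<^esub> Y \<otimes>\<^bsub>subquotient Z B\<^esub> W = X \<otimes>\<^bsub>subquotient Z B\<^esub> (Y \<otimes>\<^bsub>subquotient Z B\<^esub> W)"
    using x y w by (simp add: mult_subquotient[OF B] add.assoc)
qed

text \<open>\<open>U\<close> and its image under \<open>L\<close> form a direct sum that splits
  \<open>Z\<close> and \<open>B\<close> compatibly, hence also the quotient. In the application
  \<open>U\<close> is the kernel of the contraction.\<close>

lemma subquotient_decomposition:
  fixes L :: "'a::ab_group_add \<Rightarrow> 'a"
  assumes L: "\<And>x y. L (x - y) = L x - L y"
    and U: "add_subgroup U"
    and uniq: "\<And>u w. u \<in> U \<Longrightarrow> w \<in> U \<Longrightarrow> u + L w = 0 \<Longrightarrow> u = 0 \<and> w = 0"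
    and Z1: "add_subgroup Z1" "Z1 \<subseteq> U" and B1: "add_subgroup B1" "B1 \<subseteq> U"
    and Z2: "add_subgroup Z2" "Z2 \<subseteq> U" and B2: "add_subgroup B2" "B2 \<subseteq> U"
    and Z: "Z = {u + L w | u w. u \<in> Z1 \<and> w \<in> Z2}"
    and B: "B = {u + L w | u w. u \<in> B1 \<and> w \<in> B2}"
  shows "subquotient Z B \<cong> subquotient Z1 B1 \<times>\<times> subquotient Z2 B2"
proof -
  have L0: "L 0 = 0" using L[of 0 0] by simp
  have L_uminus: "L (- y) = - L y" for y using L[of 0 y] L0 by simp
  have L_add: "L (x + y) = L x + L y" for x y using L[of x "- y"] L_uminus[of y] by simp
  have subB: "add_subgroup B"
    unfolding add_subgroup_def
  proof (intro conjI ballI)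
    show "0 \<in> B" using add_subgroupD(1)[OF B1(1)] add_subgroupD(1)[OF B2(1)] L0
      unfolding B by (metis (mono_tags, lifting) add_0 mem_Collect_eq)
    fix x y assume "x \<in> B" "y \<in> B"
    then obtain u w u' w' where *: "x = u + L w" "y = u' + L w'"
        "u \<in> B1" "w \<in> B2" "u' \<in> B1" "w' \<in> B2"
      by (auto simp: B)
    then have "x - y = (u - u') + L (w - w')" "u - u' \<in> B1" "w - w' \<in> B2"
      using add_subgroupD(2) B1 B2 by (auto simp: L)
    then show "x - y \<in> B" unfolding B by blast
  qed
  \<comment> \<open>Defined on cosets as sets, so that no representatives need to be chosen. The map
    runs from the product to the quotient; the isomorphism is inverted at the end.\<close>
  define \<psi> where "\<psi> = (\<lambda>(X, Y). {x + L y | x y. x \<in> X \<and> y \<in> Y})"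
  have \<psi>: "\<psi> (add_coset B1 u, add_coset B2 w) = add_coset B (u + L w)" for u w
  proof (intro equalityI subsetI)
    fix z assume "z \<in> \<psi> (add_coset B1 u, add_coset B2 w)"
    then obtain b c where "b \<in> B1" "c \<in> B2" "z = (b + u) + L (c + w)"
      by (auto simp: \<psi>_def add_coset_def)
    then have "z = (b + L c) + (u + L w)" "b + L c \<in> B"
      by (auto simp: L_add B algebra_simps)
    then show "z \<in> add_coset B (u + L w)" unfolding add_coset_def by blast
  next
    fix z assume "z \<in> add_coset B (u + L w)"
    then obtain b c where "b \<in> B1" "c \<in> B2" "z = (b + L c) + (u + L w)"
      by (auto simp: B add_coset_def)
    then have "z = (b + u) + L (c + w)" "b + u \<in> add_coset B1 u" "c + w \<in> add_coset B2 w"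
      by (auto simp: L_add add_coset_def algebra_simps)
    then show "z \<in> \<psi> (add_coset B1 u, add_coset B2 w)" unfolding \<psi>_def by blast
  qed
  have "\<psi> \<in> iso (subquotient Z1 B1 \<times>\<times> subquotient Z2 B2) (subquotient Z B)"
  proof (rule isoI)
    show "\<psi> \<in> hom (subquotient Z1 B1 \<times>\<times> subquotient Z2 B2) (subquotient Z B)"
    proof (rule homI)
      fix p assume "p \<in> carrier (subquotient Z1 B1 \<times>\<times> subquotient Z2 B2)"
      then obtain u w where p: "p = (add_coset B1 u, add_coset B2 w)" "u \<in> Z1" "w \<in> Z2"
        by (auto simp: carrier_subquotient)
      show "\<psi> p \<in> carrier (subquotient Z B)"
        using p by (auto simp: carrier_subquotient \<psi> Z)
      fix q assume "q \<in> carrier (subquotient Z1 B1 \<times>\<times> subquotient Z2 B2)"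
      then obtain u' w' where q: "q = (add_coset B1 u', add_coset B2 w')"
        by (auto simp: carrier_subquotient)
      show "\<psi> (p \<otimes>\<^bsub>subquotient Z1 B1 \<times>\<times> subquotient Z2 B2\<^esub> q) = \<psi> p \<otimes>\<^bsub>subquotient Z B\<^esub> \<psi> q"
        using p q by (simp add: \<psi> mult_subquotient B1 B2 subB L_add algebra_simps)
    qed
    have "inj_on \<psi> (carrier (subquotient Z1 B1 \<times>\<times> subquotient Z2 B2))"
    proof (rule inj_onI)
      fix p q
      assume "p \<in> carrier (subquotient Z1 B1 \<times>\<times> subquotient Z2 B2)"
        and "q \<in> carrier (subquotient Z1 B1 \<times>\<times> subquotient Z2 B2)" and eq: "\<psi> p = \<psi> q"
      then obtain u w u' w' where pq: "p = (add_coset B1 u, add_coset B2 w)" "q = (add_coset B1 u', add_coset B2 w')"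
          "u \<in> Z1" "w \<in> Z2" "u' \<in> Z1" "w' \<in> Z2"
        by (auto simp: carrier_subquotient)
      have "(u + L w) - (u' + L w') \<in> B"
        using eq pq by (simp add: \<psi> add_coset_eq_iff[OF subB])
      then obtain b c where bc: "b \<in> B1" "c \<in> B2" "(u + L w) - (u' + L w') = b + L c"
        by (auto simp: B)
      \<comment> \<open>Directness applied to this expression forces \<open>u - u' = b\<close> and
        \<open>w - w' = c\<close>, hence equality of both pairs of cosets.\<close>
      have "(u - u' - b) + L (w - w' - c) = ((u + L w) - (u' + L w')) - (b + L c)"
        by (simp add: L L_add algebra_simps)
      then have "(u - u' - b) + L (w - w' - c) = 0" using bc(3) by simp
      moreover have "u \<in> U" "u' \<in> U" "w \<in> U" "w' \<in> U" "b \<in> U" "c \<in> U"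
        using pq(3-6) bc(1,2) Z1(2) Z2(2) B1(2) B2(2) by blast+
      then have "u - u' - b \<in> U" "w - w' - c \<in> U"
        by (simp_all add: add_subgroupD(2)[OF U])
      ultimately have "u - u' = b" "w - w' = c" using uniq by force+
      then show "p = q" using pq bc by (simp add: add_coset_eq_iff B1 B2)
    qed
    moreover have "\<psi> ` carrier (subquotient Z1 B1 \<times>\<times> subquotient Z2 B2) = carrier (subquotient Z B)"
    proof (intro equalityI subsetI)
      fix X assume "X \<in> \<psi> ` carrier (subquotient Z1 B1 \<times>\<times> subquotient Z2 B2)"
      then obtain u w where "X = add_coset B (u + L w)" "u \<in> Z1" "w \<in> Z2"
        by (auto simp: carrier_subquotient \<psi>)
      then show "X \<in> carrier (subquotient Z B)" unfolding carrier_subquotient Z by blast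
    next
      fix X assume "X \<in> carrier (subquotient Z B)"
      then obtain u w where "u \<in> Z1" "w \<in> Z2" "X = \<psi> (add_coset B1 u, add_coset B2 w)"
        by (auto simp: carrier_subquotient \<psi> Z)
      then show "X \<in> \<psi> ` carrier (subquotient Z1 B1 \<times>\<times> subquotient Z2 B2)"
        by (auto simp: carrier_subquotient)
    qed
    ultimately show "bij_betw \<psi> (carrier (subquotient Z1 B1 \<times>\<times> subquotient Z2 B2)) (carrier (subquotient Z B))"
      by (simp add: bij_betw_def)
  qed
  moreover have "group (subquotient Z1 B1 \<times>\<times> subquotient Z2 B2)"
    using comm_group_subquotient Z1 Z2 B1 B2 by (intro DirProd_group comm_group.axioms(2)) auto
  ultimately show ?thesis using group.iso_sym is_isoI by blast
qed

section \<open>Splitting of odd Khovanov homology\<close>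

lemma odd_Kh_eq_subquotient:
  "odd_Kh D arr \<epsilon> m s = subquotient {c \<in> carrier (chain_group D m s). boundary D arr \<epsilon> c = 0}
     (boundary D arr \<epsilon> ` carrier (chain_group D (m - 1) s))"
  by (simp add: odd_Kh_def subquotient_def kernel_def chain_group_def)

theorem proposition1p7:
  fixes D :: diagram
    and arr :: "nat \<Rightarrow> bool"
    and \<epsilon> :: "(nat \<Rightarrow> nat) \<times> nat \<Rightarrow> int"
  assumes "planar_diagram D"
    and "diagram_edges D \<noteq> {}"
    and "edge_assignment_X D arr \<epsilon> \<or> edge_assignment_Y D arr \<epsilon>"
  shows "\<exists>Kh_red :: int \<Rightarrow> int \<Rightarrow> chain set monoid.
           (\<forall>m s. comm_group (Kh_red m s)) \<and>
           (\<forall>m s. odd_Kh D arr \<epsilon> m s \<cong> Kh_red m (s - 1) \<times>\<times> Kh_red m (s + 1))"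
proof -
  have "finite (diagram_edges D)"
    using assms(1) by (simp add: planar_diagram_def diagram_edges_def corners_def)
  with assms(2) interpret finite_diagram D by unfold_locales
  let ?C = "\<lambda>m s. carrier (chain_group D m s)"
  let ?K = chain_lower and ?L = chain_raise and ?d = "boundary D arr \<epsilon>"
  note K_diff = chain_lower_diff and L_diff = chain_raise_diff
  have C: "c \<in> chains" if "c \<in> ?C m s" for c m s
    using that carrier_chain_group_sub by blast
  have K0: "?K 0 = 0" and L0: "?L 0 = 0" and d0: "?d 0 = 0"
    using K_diff[of 0 0] L_diff[of 0 0] boundary_diff[of 0 0 arr \<epsilon>] C[OF carrier_chain_group_0]
    by simp_all
  \<comment> \<open>\<open>R\<close> is the reduced complex in one bidegree and \<open>Z\<close> its
    cycles; \<open>U\<close> forgets the bidegree, so that it contains the summands from both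
    q-degrees.\<close>
  define R where "R m s = {c \<in> ?C m s. ?K c = 0}" for m s
  define Z where "Z m s = {c \<in> R m s. ?d c = 0}" for m s
  define U where "U = {c \<in> chains. ?K c = 0}"
  have KL: "?K (?L w) = w" if "w \<in> U" for w
    using chain_lower_raise[of w] that L0 by (simp add: U_def)
  have R: "add_subgroup (R m s)" "R m s \<subseteq> U" for m s
    using C carrier_chain_group_0 carrier_chain_group_diff K0 K_diff
    by (auto simp: add_subgroup_def R_def U_def)
  have U: "add_subgroup U"
    using C[OF carrier_chain_group_0] chains_diff K0 K_diff by (auto simp: add_subgroup_def U_def)
  have d_diff: "?d (c - c') = ?d c - ?d c'" if "c \<in> U" "c' \<in> U" for c c'
    using that boundary_diff by (simp add: U_def)
  have d_add: "?d (c + ?L w) = ?d c + ?L (?d w)" if "c \<in> U" "w \<in> U" for c w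
  proof -
    have "?L w \<in> chains" "?L (- w) = - ?L w" "- w \<in> U"
      using that chain_raise_in L_diff[of 0 w] L0 add_subgroupD(3)[OF U] by (auto simp: U_def)
    then have "?d (c - ?L (- w)) = ?d c - ?L (?d (- w))"
      using boundary_diff[of c "?L (- w)"] boundary_raise[of "- w"] chain_raise_in[of "- w"] that
      by (simp add: U_def)
    moreover have "?d (- w) = - ?d w"
      using d_diff[OF add_subgroupD(1)[OF U] that(2)] d0 by simp
    ultimately show ?thesis using L_diff[of 0] L0 by simp
  qed
  have Z: "add_subgroup (Z m s)" "Z m s \<subseteq> U" for m s
    using R[of m s] d0 d_diff by (auto simp: add_subgroup_def Z_def subset_iff)
  have dR: "add_subgroup (?d ` R m s)" "?d ` R m s \<subseteq> U" for m s
  proof -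
    show "add_subgroup (?d ` R m s)"
      unfolding add_subgroup_def
    proof (intro conjI ballI)
      show "0 \<in> ?d ` R m s" using d0 add_subgroupD(1)[OF R(1)] by force
      fix x y assume "x \<in> ?d ` R m s" "y \<in> ?d ` R m s"
      then obtain c c' where c: "c \<in> R m s" "c' \<in> R m s" "x = ?d c" "y = ?d c'" by blast
      then have "x - y = ?d (c - c')" using d_diff R(2) by (metis subsetD)
      then show "x - y \<in> ?d ` R m s" using c add_subgroupD(2)[OF R(1)] by blast
    qed
    show "?d ` R m s \<subseteq> U"
      using R(2) boundary_in boundary_lower[symmetric] d0 by (fastforce simp: U_def)
  qed
  have uniq: "u = 0 \<and> w = 0" if "u \<in> U" "w \<in> U" "u + ?L w = 0" for u w
  proof -
    \<comment> \<open>Contraction kills \<open>u\<close> and returns \<open>w\<close> from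
      \<open>?L w\<close>, so it isolates the second component.\<close>
    have "?L w = 0 - u" using that(3) by (simp add: eq_neg_iff_add_eq_0 add.commute)
    then have "?K (?L w) = ?K 0 - ?K u" using K_diff by metis
    then have "w = 0" using KL that(1,2) K0 by (simp add: U_def)
    then show ?thesis using that(3) L0 by simp
  qed
  \<comment> \<open>Both components lie in the kernel of \<open>?K\<close> because \<open>?K\<close>
    squares to 0. \<open>?K\<close> raises the q-grading by 2 and \<open>?L\<close> lowers it by 2,
    so the first component has degree \<open>s\<close> and the second \<open>s + 2\<close>.\<close>
  have split_C: "\<exists>u w. u \<in> R m s \<and> w \<in> R m (s + 2) \<and> u = ?K (?L c) \<and> w = ?K c \<and> c = u + ?L w"
    if "c \<in> ?C m s" for c m s
  proof -
    have "?K c \<in> R m (s + 2)"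
      using that chain_lower_degree chain_lower_lower C by (auto simp: R_def)
    moreover have "?K (?L c) \<in> R m s"
      using that chain_lower_degree[of _ m "s - 2"] chain_raise_degree[of c m s "s - 2"]
        chain_lower_lower chain_raise_in C by (auto simp: R_def)
    ultimately show ?thesis using chain_lower_raise[OF C[OF that]] by auto
  qed
  have join_C: "u + ?L w \<in> ?C m s" if "u \<in> R m s" "w \<in> R m (s + 2)" for u w m s
  proof -
    have "- ?L w \<in> ?C m s"
      using that chain_raise_degree[of w m "s + 2" s] carrier_chain_group_diff[OF carrier_chain_group_0]
      by (fastforce simp: R_def)
    from carrier_chain_group_diff[OF _ this, of u] show ?thesis
      using that by (simp add: R_def)
  qed
  have cycles: "{c \<in> ?C m s. ?d c = 0} = {u + ?L w | u w. u \<in> Z m s \<and> w \<in> Z m (s + 2)}" for m s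
  proof (intro equalityI subsetI)
    fix c assume c: "c \<in> {c \<in> ?C m s. ?d c = 0}"
    then obtain u w where uw: "u \<in> R m s" "w \<in> R m (s + 2)" "u = ?K (?L c)" "w = ?K c" "c = u + ?L w"
      using split_C by blast
    have "c \<in> chains" using c C by blast
    \<comment> \<open>The components are given by operators that commute with the boundary, so those
      of \<open>?d c\<close> are \<open>?d u\<close> and \<open>?d w\<close>.\<close>
    then have "?d u = ?K (?L (?d c))" "?d w = ?K (?d c)"
      unfolding uw(3,4) by (simp_all only: boundary_lower boundary_raise chain_raise_in)
    then have "?d u = 0" "?d w = 0" using c K0 L0 by simp_all
    then show "c \<in> {u + ?L w | u w. u \<in> Z m s \<and> w \<in> Z m (s + 2)}"
      using uw(1,2,5) unfolding Z_def by blast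
  next
    fix c assume "c \<in> {u + ?L w | u w. u \<in> Z m s \<and> w \<in> Z m (s + 2)}"
    then obtain u w where uw: "c = u + ?L w" "u \<in> Z m s" "w \<in> Z m (s + 2)" by blast
    then have "?d c = 0" using d_add Z(2) L0 by (auto simp: Z_def subset_iff)
    then show "c \<in> {c \<in> ?C m s. ?d c = 0}" using uw join_C by (auto simp: Z_def)
  qed
  have boundaries: "?d ` ?C m s = {u + ?L w | u w. u \<in> ?d ` R m s \<and> w \<in> ?d ` R m (s + 2)}" for m s
  proof (intro equalityI subsetI)
    fix b assume "b \<in> ?d ` ?C m s"
    then obtain c where c: "c \<in> ?C m s" "b = ?d c" by blast
    then obtain u w where "b = ?d (u + ?L w)" "u \<in> R m s" "w \<in> R m (s + 2)"
      using split_C[OF c(1)] by metis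
    moreover from this have "b = ?d u + ?L (?d w)" using d_add R(2) by blast
    ultimately show "b \<in> {u + ?L w | u w. u \<in> ?d ` R m s \<and> w \<in> ?d ` R m (s + 2)}" by blast
  next
    fix b assume "b \<in> {u + ?L w | u w. u \<in> ?d ` R m s \<and> w \<in> ?d ` R m (s + 2)}"
    then obtain u w where uw: "b = ?d u + ?L (?d w)" "u \<in> R m s" "w \<in> R m (s + 2)" by blast
    then have "b = ?d (u + ?L w)"
      using d_add[OF subsetD[OF R(2) uw(2)] subsetD[OF R(2) uw(3)]] by simp
    then show "b \<in> ?d ` ?C m s" using uw join_C by blast
  qed
  \<comment> \<open>The shift by 1 places the summands from degrees \<open>s\<close> and
    \<open>s + 2\<close> symmetrically at \<open>s - 1\<close> and \<open>s + 1\<close>.\<close>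
  define Kh_red where "Kh_red m s = subquotient (Z m (s + 1)) (?d ` R (m - 1) (s + 1))" for m s
  have "comm_group (Kh_red m s)" for m s
    unfolding Kh_red_def using Z(1) dR(1) by (rule comm_group_subquotient)
  moreover have "odd_Kh D arr \<epsilon> m s \<cong> Kh_red m (s - 1) \<times>\<times> Kh_red m (s + 1)" for m s
  proof -
    have "odd_Kh D arr \<epsilon> m s \<cong>
        subquotient (Z m s) (?d ` R (m - 1) s) \<times>\<times> subquotient (Z m (s + 2)) (?d ` R (m - 1) (s + 2))"
      unfolding odd_Kh_eq_subquotient
      by (rule subquotient_decomposition[OF L_diff U uniq Z dR Z dR cycles boundaries])
    then show ?thesis by (simp add: Kh_red_def add.assoc)
  qed
  ultimately show ?thesis by blast
qed

end
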